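(* Let $\mathbb{K}$ be an arbitrary field and $(p,q,r)\in\mathbb{K}^3$. The algebra $Q^{p,q,r}$ is PBW if and only if at least one of the following conditions is satisfied: (1) $pr=qr=0$; (2) $p^3=q^3=r^3$; (3) $(p+q)^3+r^3=0$ and the equation $t^2+t+1=0$ is solvable in $\mathbb{K}$.
   Context: For $(p,q,r)\in\mathbb{K}^3$, the Sklyanin algebra $Q^{p,q,r}$ is the associative unital $\mathbb{K}$-algebra with generators $x,y,z$ and the three relations $pyz+qzy+rxx=0$, $pzx+qxz+ryy=0$, $pxy+qyx+rzz=0$. For a finite-dimensional vector space $V$ and a subspace $R\subseteq V\otimes V$, $A(V,R)$ denotes the quotient of the tensor algebra of $V$ by the ideal $I$ generated by $R$ (a quadratic algebra). The quadratic algebra $A(V,R)$ is PBW if there are linear bases $x_1,\dots,x_n$ of $V$ and $g_1,\dots,g_m$ of $R$ such that, with respect to some well-ordering on the monomials in $x_1,\dots,x_n$ compatible with multiplication, $g_1,\dots,g_m$ is a (non-commutative) Gröbner basis of the ideal $I$. For $Q^{p,q,r}$, $V$ is the span of $x,y,z$ and $R$ is the span of the three defining relations. *)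

theory Defs
  imports Complex_Main "HOL-Library.Poly_Mapping"
begin

section \<open>The free algebra on a set of letters\<close>

instantiation list :: (type) monoid_add
begin

definition zero_list :: "'a list" where
  "zero_list = []"

definition plus_list :: "'a list \<Rightarrow> 'a list \<Rightarrow> 'a list" where
  "plus_list u v = u @ v"

instance
  by standard (simp_all add: zero_list_def plus_list_def)

end

text \<open>
  With concatenation as addition of words, the convolution product of \<^theory>\<open>HOL-Library.Poly_Mapping\<close>
  makes the type of finitely supported functions from words to \<open>'k\<close> the free associative unital
  \<open>'k\<close>-algebra on the letters \<open>'x\<close>. For a finite type \<open>'x\<close> it is the tensor algebra of the space \<open>V\<close>
  of dimension \<open>CARD('x)\<close> spanned by the letters.
\<close>

type_synonym ('x, 'k) free_algebra = "'x list \<Rightarrow>\<^sub>0 'k"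

definition scale :: "'k::field \<Rightarrow> ('x, 'k) free_algebra \<Rightarrow> ('x, 'k) free_algebra" where
  "scale c f = Poly_Mapping.single 0 c * f"

global_interpretation free_algebra: vector_space scale
  by standard
    (simp_all add: scale_def distrib_left distrib_right single_add mult_single mult.assoc [symmetric])

definition letter :: "'x \<Rightarrow> ('x, 'k::field) free_algebra" where
  "letter a = Poly_Mapping.single [a] 1"

definition degree_one :: "('x, 'k::field) free_algebra set" where
  "degree_one = free_algebra.span (range letter)"

definition degree_two :: "('x, 'k::field) free_algebra set" where
  "degree_two = free_algebra.span {u * v | u v. u \<in> degree_one \<and> v \<in> degree_one}"

definition linear_basis :: "('x, 'k::field) free_algebra set \<Rightarrow> ('x, 'k) free_algebra set \<Rightarrow> bool" where
  "linear_basis B W \<longleftrightarrow> free_algebra.independent B \<and> free_algebra.span B = W"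

definition two_sided_ideal :: "'a::ring_1 set \<Rightarrow> bool" where
  "two_sided_ideal I \<longleftrightarrow>
     0 \<in> I \<and> (\<forall>f\<in>I. \<forall>g\<in>I. f + g \<in> I) \<and> (\<forall>f\<in>I. \<forall>a. a * f \<in> I \<and> f * a \<in> I)"


section \<open>Non-commutative Groebner bases\<close>

definition monomials :: "('x, 'k::field) free_algebra set \<Rightarrow> ('x, 'k) free_algebra set" where
  "monomials B = prod_list ` lists B"

text \<open>In an order relation \<open>r\<close>, the membership \<open>(u, v) \<in> r\<close> means \<open>u \<le> v\<close>.\<close>

definition monomial_order ::
  "('x, 'k::field) free_algebra set \<Rightarrow> ('x, 'k) free_algebra rel \<Rightarrow> bool" where
  "monomial_order B r \<longleftrightarrow> well_order_on (monomials B) r \<and>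
     (\<forall>(u, v) \<in> r. \<forall>w \<in> monomials B. (w * u, w * v) \<in> r \<and> (u * w, v * w) \<in> r)"

text \<open>
  If \<open>B\<close> is a linear basis of \<^const>\<open>degree_one\<close>, then \<open>monomials B\<close> is a linear basis of the whole free
  algebra, so \<open>representation (monomials B) f m\<close> is the coefficient of the monomial \<open>m\<close> in \<open>f\<close>.
\<close>

definition monomial_support :: "('x, 'k::field) free_algebra set \<Rightarrow> ('x, 'k) free_algebra \<Rightarrow> ('x, 'k) free_algebra set" where
  "monomial_support B f = {m. free_algebra.representation (monomials B) f m \<noteq> 0}"

definition leading_monomial ::
  "('x, 'k::field) free_algebra set \<Rightarrow> ('x, 'k) free_algebra rel \<Rightarrow> ('x, 'k) free_algebra \<Rightarrow>
     ('x, 'k) free_algebra" where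
  "leading_monomial B r f = (THE m. m \<in> monomial_support B f \<and> (\<forall>m' \<in> monomial_support B f. (m', m) \<in> r))"

definition groebner_basis ::
  "('x, 'k::field) free_algebra set \<Rightarrow> ('x, 'k) free_algebra rel \<Rightarrow> ('x, 'k) free_algebra set \<Rightarrow>
     ('x, 'k) free_algebra set \<Rightarrow> bool" where
  "groebner_basis B r G I \<longleftrightarrow> G \<subseteq> I \<and>
     (\<forall>f \<in> I - {0}. \<exists>g \<in> G - {0}. \<exists>u \<in> monomials B. \<exists>v \<in> monomials B.
        leading_monomial B r f = u * leading_monomial B r g * v)"


section \<open>PBW algebras\<close>

text \<open>
  The quadratic algebra \<open>A(V, R)\<close> is the quotient of the free algebra by the two-sided ideal generated
  by \<open>R\<close>. It is represented by the space of relations \<open>R\<close>, a subspace of \<^const>\<open>degree_two\<close>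
  (that is, of \<open>V \<otimes> V\<close>), since being PBW is a property of the pair \<open>(V, R)\<close>.
\<close>

definition PBW :: "('x::finite, 'k::field) free_algebra set \<Rightarrow> bool" where
  "PBW R \<longleftrightarrow> (\<exists>B G r. linear_basis B degree_one \<and> linear_basis G R \<and>
     monomial_order B r \<and> groebner_basis B r G (two_sided_ideal hull R))"


section \<open>Sklyanin algebras\<close>

datatype xyz = X | Y | Z

instance xyz :: finite
proof
  have "UNIV = {X, Y, Z}"
    using xyz.exhaust by auto
  then show "finite (UNIV :: xyz set)"
    by (metis finite.emptyI finite.insertI)
qed

definition sklyanin_relations :: "'k::field \<Rightarrow> 'k \<Rightarrow> 'k \<Rightarrow> (xyz, 'k) free_algebra set" where
  "sklyanin_relations p q r = (let x = letter X; y = letter Y; z = letter Z in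
     free_algebra.span
       {scale p (y * z) + scale q (z * y) + scale r (x * x),
        scale p (z * x) + scale q (x * z) + scale r (y * y),
        scale p (x * y) + scale q (y * x) + scale r (z * z)})"

lemma sklyanin_relations_subset: "sklyanin_relations p q r \<subseteq> degree_two"
proof -
  have "letter a * letter b \<in> (degree_two :: (xyz, 'a) free_algebra set)" for a b
    unfolding degree_two_def degree_one_def
    by (rule free_algebra.span_base) (blast intro: free_algebra.span_base)
  then show ?thesis
    unfolding sklyanin_relations_def Let_def
    by (intro free_algebra.span_minimal)
      (auto simp: degree_two_def intro!: free_algebra.span_add free_algebra.span_scale)
qed

end

theory Submission
  imports Defs
begin

text \<open>
  A basis of the space of letters is the same thing as an invertible linear substitution of the letters,
  so an algebra is PBW iff after such a substitution the relations have a basis that is a Groebner basis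
  with respect to an order on words (\<open>PBW_iff\<close>). Write \<open>R1\<close>, \<open>R2\<close>, \<open>R3\<close> for the three relations.

  The conditions are sufficient by the diamond lemma (\<open>PBW_of_rules\<close>): quadratic rules form a Groebner
  basis if for each overlap \<open>abc\<close> of two leading words \<open>ab\<close> and \<open>bc\<close> the two ways of rewriting
  \<open>abc\<close> differ by rules applied below \<open>abc\<close>. Every Sklyanin algebra has the syzygy
  \<open>[x, R1] + [y, R2] + [z, R3] = 0\<close>, and it resolves almost all overlaps that occur.
  If \<open>pr = qr = 0\<close>, the relations are monomials or, if \<open>r = 0\<close>, have the leading words \<open>xy\<close>, \<open>xz\<close>,
  \<open>yz\<close>, whose only overlap \<open>xyz\<close> is resolved by the syzygy. If \<open>p\<^sup>3 = q\<^sup>3 = r\<^sup>3 \<noteq> 0\<close>, the leading words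
  are \<open>xx\<close>, \<open>xy\<close>, \<open>xz\<close>; the syzygy resolves \<open>xxx\<close>, and \<open>xxy\<close> and \<open>xxz\<close> resolve because of the
  equality of the cubes. In the third case, rescaling \<open>x\<close> by a cube root of unity makes
  \<open>p + q + r = 0\<close>, so that the relations, as bilinear forms, vanish at the point \<open>(1, 1, 1)\<close>. In new letters
  adapted to a flag with this point the leading words are again \<open>xy\<close>, \<open>xz\<close>, \<open>yz\<close>, and the syzygy
  resolves \<open>xyz\<close>; the leading coefficients are nonzero unless \<open>p\<^sup>3 = q\<^sup>3 = r\<^sup>3\<close>. This works in every
  characteristic: in characteristic 3 the primitive cube root of unity is simply replaced by 1.

  For the converse, let \<open>r \<noteq> 0\<close>, \<open>(p, q) \<noteq> (0, 0)\<close>, and let the cubes of \<open>p\<close>, \<open>q\<close>, \<open>r\<close> not all be equal.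
  Then the syzygy is, up to scaling, the only linear relation between the 18 products of a letter and one
  of \<open>R1\<close>, \<open>R2\<close>, \<open>R3\<close> (\<open>cubic_relations_independent\<close>), so in degree 3 the ideal has dimension at least 17.
  The leading words of a quadratic Groebner basis are at most three words of length 2, and at least 17
  words of length 3 must contain one of them. Counting shows that they have just one overlap, hence none
  of them is a square \<open>aa\<close>, and for \<open>b \<noteq> c\<close> one of \<open>bc\<close>, \<open>cb\<close> is among them (\<open>leading_words_acyclic\<close>).
  Let \<open>i > j > k\<close> be the new letters. Because \<open>ii\<close> is the largest word of length 2 and not a leading
  word, all relations vanish at the point dual to \<open>i\<close>; this gives \<open>(p + q)\<^sup>3 + r\<^sup>3 = 0\<close> and shows that the
  coordinates of the point have equal cubes. If \<open>t\<^sup>2 + t + 1\<close> had no root, the point would be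
  \<open>(1, 1, 1)\<close> up to scaling. The relation with leading word \<open>jk\<close> or \<open>kj\<close> contains no word that begins
  (respectively ends) with \<open>i\<close>; so its coordinates with respect to \<open>R1\<close>, \<open>R2\<close>, \<open>R3\<close> are in the kernel of a
  circulant matrix, and it is a multiple of \<open>R1 + R2 + R3\<close>. It does not contain \<open>jj\<close> either, that is, the form
  \<open>x\<^sup>2 + y\<^sup>2 + z\<^sup>2 - xy - yz - zx\<close> vanishes at a point that is not a multiple of \<open>(1, 1, 1)\<close>. As a binary
  form in \<open>a = x - y\<close> and \<open>b = y - z\<close> it is \<open>a\<^sup>2 + ab + b\<^sup>2\<close>, so \<open>t\<^sup>2 + t + 1\<close> has a root after all.
\<close>


section \<open>Words and substitutions in the free algebra\<close>

abbreviation coeff :: "('x, 'k::field) free_algebra \<Rightarrow> 'x list \<Rightarrow> 'k" where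
  "coeff \<equiv> Poly_Mapping.lookup"

abbreviation support :: "('x, 'k::field) free_algebra \<Rightarrow> 'x list set" where
  "support \<equiv> Poly_Mapping.keys"

definition word :: "'x list \<Rightarrow> ('x, 'k::field) free_algebra" where
  "word w = Poly_Mapping.single w 1"

lemma word_Nil [simp]: "word [] = 1"
  by (metis single_one word_def zero_list_def)

lemma word_mult [simp]: "word u * word v = word (u @ v)"
  by (simp add: word_def mult_single plus_list_def)

lemma lookup_word: "coeff (word w) v = (if w = v then 1 else 0)"
  by (simp add: word_def lookup_single when_def)

lemma word_inject [simp]: "(word u :: ('x, 'k::field) free_algebra) = word v \<longleftrightarrow> u = v"
  by (metis lookup_word zero_neq_one)

lemma letter_eq_word: "letter a = word [a]"
  by (simp add: letter_def word_def)

lemma lookup_scale [simp]: "coeff (scale c f) w = c * coeff f w"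
proof -
  have "scale c f = Poly_Mapping.map ((*) c) f"
    by (simp add: scale_def mult_map_scale_conv_mult)
  then show ?thesis
    by (simp add: Poly_Mapping.map.rep_eq when_def)
qed

lemma scale_mult_left: "scale c f * g = scale c (f * g)"
  by (simp add: scale_def mult.assoc)

lemma sum_words_superset:
  assumes "finite S" "support f \<subseteq> S"
  shows "(\<Sum>w\<in>S. scale (coeff f w) (word w)) = f"
proof (rule poly_mapping_eqI)
  fix v
  have "coeff (\<Sum>w\<in>S. scale (coeff f w) (word w)) v
      = (\<Sum>w\<in>S. if w = v then coeff f w else 0)"
    by (auto simp: lookup_sum lookup_word intro: sum.cong)
  also have "\<dots> = coeff f v"
    using assms by (auto simp: sum.delta in_keys_iff)
  finally show "coeff (\<Sum>w\<in>S. scale (coeff f w) (word w)) v = coeff f v" .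
qed

lemmas sum_words = sum_words_superset [OF finite_keys order_refl]

lemma span_words: "free_algebra.span (range word) = UNIV"
proof (rule UNIV_eq_I [symmetric])
  fix f :: "('x, 'k::field) free_algebra"
  have "(\<Sum>w\<in>support f. scale (coeff f w) (word w)) \<in> free_algebra.span (range word)"
    by (intro free_algebra.span_sum free_algebra.span_scale free_algebra.span_base) auto
  then show "f \<in> free_algebra.span (range word)"
    by (simp add: sum_words)
qed

lemma words_induct [case_names word add scale]:
  assumes "\<And>w. P (word w)" "\<And>f g. P f \<Longrightarrow> P g \<Longrightarrow> P (f + g)" "\<And>c f. P f \<Longrightarrow> P (scale c f)"
  shows "P f"
proof -
  have "f \<in> free_algebra.span (range word)"
    by (simp add: span_words)
  then show ?thesis
  proof (induction rule: free_algebra.span_induct_alt)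
    case base
    have "scale 0 (word []) = 0"
      by simp
    then show ?case
      using assms(1,3) by metis
  next
    case (step c x y)
    then show ?case
      using assms by auto
  qed
qed

lemma scalar_commute:
  "Poly_Mapping.single 0 c * f = f * Poly_Mapping.single (0 :: 'x list) (c :: 'k::field)"
proof (induction f rule: words_induct)
  case (word w)
  then show ?case
    by (simp add: word_def mult_single plus_list_def zero_list_def)
next
  case (scale d f)
  have "Poly_Mapping.single 0 c * Poly_Mapping.single (0 :: 'x list) d
      = Poly_Mapping.single 0 d * Poly_Mapping.single 0 c"
    by (simp add: mult_single mult.commute)
  then have "Poly_Mapping.single 0 c * scale d f
      = Poly_Mapping.single 0 d * (Poly_Mapping.single 0 c * f)"
    by (simp only: scale_def mult.assoc [symmetric])
  also have "\<dots> = scale d f * Poly_Mapping.single 0 c"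
    by (simp only: scale scale_def mult.assoc)
  finally show ?case .
qed (simp add: distrib_left distrib_right)

lemma scale_mult_right: "f * scale c g = scale c (f * g)"
  unfolding scale_def by (simp only: mult.assoc [symmetric] scalar_commute [of c f])

definition algebra_hom :: "(('x, 'k::field) free_algebra \<Rightarrow> ('y, 'k) free_algebra) \<Rightarrow> bool" where
  "algebra_hom h \<longleftrightarrow> h 1 = 1 \<and> (\<forall>f g. h (f + g) = h f + h g) \<and>
     (\<forall>c f. h (scale c f) = scale c (h f)) \<and> (\<forall>f g. h (f * g) = h f * h g)"

lemma
  assumes "algebra_hom h"
  shows algebra_hom_one: "h 1 = 1"
    and algebra_hom_add: "h (f + g) = h f + h g"
    and algebra_hom_scale: "h (scale c f) = scale c (h f)"
    and algebra_hom_mult: "h (f * g) = h f * h g"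
  using assms unfolding algebra_hom_def by auto

lemmas algebra_hom_simps = algebra_hom_one algebra_hom_add algebra_hom_scale algebra_hom_mult

lemma algebra_hom_linear: "algebra_hom h \<Longrightarrow> Vector_Spaces.linear scale scale h"
  unfolding Vector_Spaces.linear_iff
  by (simp add: free_algebra.vector_space_axioms algebra_hom_simps)

lemma algebra_hom_word:
  assumes "algebra_hom h"
  shows "h (word w) = prod_list (map (\<lambda>a. h (letter a)) w)"
proof (induction w)
  case (Cons a w)
  then show ?case
    using algebra_hom_mult [OF assms, of "letter a" "word w"] by (simp add: letter_eq_word)
qed (simp add: assms algebra_hom_one)

lemma algebra_hom_eqI:
  assumes "algebra_hom h" "algebra_hom k" "\<And>a. h (letter a) = k (letter a)"
  shows "h f = k f"
  by (induction f rule: words_induct) (simp_all add: assms algebra_hom_word algebra_hom_simps)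

definition subst ::
  "('x \<Rightarrow> ('y, 'k::field) free_algebra) \<Rightarrow> ('x, 'k) free_algebra \<Rightarrow> ('y, 'k) free_algebra" where
  "subst b f = (\<Sum>w\<in>support f. scale (coeff f w) (prod_list (map b w)))"

lemma subst_superset:
  assumes "finite S" "support f \<subseteq> S"
  shows "subst b f = (\<Sum>w\<in>S. scale (coeff f w) (prod_list (map b w)))"
  unfolding subst_def using assms
  by (intro sum.mono_neutral_left) (auto simp: in_keys_iff)

lemma subst_add: "subst b (f + g) = subst b f + subst b g"
proof -
  have "support (f + g) \<subseteq> support f \<union> support g"
    by (rule keys_add)
  then show ?thesis
    by (simp add: subst_superset [of "support f \<union> support g"] lookup_add
        free_algebra.scale_left_distrib sum.distrib)
qed

lemma subst_scale: "subst b (scale c f) = scale c (subst b f)"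
proof -
  have "support (scale c f) \<subseteq> support f"
    by (auto simp: in_keys_iff)
  then show ?thesis
    by (simp add: subst_superset [of "support f"] free_algebra.scale_sum_right)
qed

lemma subst_word: "subst b (word w) = prod_list (map b w)"
  by (simp add: subst_superset [of "{w}"] word_def)

lemma algebra_hom_subst: "algebra_hom (subst b)"
proof -
  have word_word: "subst b (word u * g) = subst b (word u) * subst b g" for u g
    by (induction g rule: words_induct)
      (simp_all add: subst_word subst_add subst_scale distrib_left scale_mult_right)
  have "subst b (f * g) = subst b f * subst b g" for f g
    by (induction f rule: words_induct)
      (simp_all add: word_word subst_add subst_scale distrib_right scale_mult_left)
  moreover have "subst b 1 = 1"
    using subst_word [of b "[]"] by simp
  ultimately show ?thesis
    by (simp add: algebra_hom_def subst_add subst_scale)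
qed

lemma subst_letter [simp]: "subst b (letter a) = b a"
  by (simp add: letter_eq_word subst_word)


section \<open>Elements of degree one and two\<close>

lemma family_independentI:
  assumes "finite S"
    and zero: "\<And>c s. (\<Sum>s\<in>S. scale (c s) (e s)) = 0 \<Longrightarrow> s \<in> S \<Longrightarrow> c s = 0"
  shows "inj_on e S" "free_algebra.independent (e ` S)"
proof -
  show inj: "inj_on e S"
  proof (rule inj_onI, rule ccontr)
    fix s t assume st: "s \<in> S" "t \<in> S" "e s = e t" "s \<noteq> t"
    let ?c = "\<lambda>u. if u = s then 1 else if u = t then - 1 else 0"
    have "(\<Sum>u\<in>S. scale (?c u) (e u))
        = (\<Sum>u\<in>S. (if u = s then e s else 0) - (if u = t then e t else 0))"
      using st(4) by (intro sum.cong) auto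
    also have "\<dots> = 0"
      using st assms(1) by (simp add: sum_subtractf)
    finally show False
      using zero [of ?c s] st(1) by simp
  qed
  show "free_algebra.independent (e ` S)"
  proof (rule free_algebra.independent_if_scalars_zero)
    fix c f assume "(\<Sum>f\<in>e ` S. scale (c f) f) = 0" "f \<in> e ` S"
    then show "c f = 0"
      using zero [of "\<lambda>s. c (e s)"] inj by (auto simp: sum.reindex)
  qed (simp add: assms)
qed

lemma letter_in_degree_one [simp]: "letter a \<in> degree_one"
  by (simp add: degree_one_def free_algebra.span_base)

lemma independent_words: "free_algebra.independent (word ` S)"
  unfolding free_algebra.independent_explicit_module
proof (intro allI impI)
  fix T u v
  assume T: "finite T" "T \<subseteq> word ` S" "(\<Sum>v\<in>T. scale (u v) v) = 0" "v \<in> T"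
  then obtain W where W: "T = word ` W" "finite W"
    using finite_subset_image [OF T(1,2)] by blast
  then obtain w where w: "w \<in> W" "v = word w"
    using T(4) by blast
  have "0 = coeff (\<Sum>x\<in>W. scale (u (word x)) (word x)) w"
    using T(3) W by (simp add: sum.reindex inj_on_def)
  also have "\<dots> = (\<Sum>x\<in>W. if x = w then u (word x) else 0)"
    by (auto simp: lookup_sum lookup_word intro: sum.cong)
  also have "\<dots> = u v"
    using w W by simp
  finally show "u v = 0"
    by simp
qed

lemma independent_letters:
  "free_algebra.independent (range (letter :: 'x \<Rightarrow> ('x, 'k::field) free_algebra))"
proof -
  have "range letter = word ` range (\<lambda>a. [a :: 'x])"
    by (auto simp: letter_eq_word)
  then show ?thesis
    by (metis independent_words)
qed

lemma degree_one_sum: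
  fixes f :: "('x::finite, 'k::field) free_algebra"
  assumes "f \<in> degree_one"
  obtains m where "f = (\<Sum>a\<in>UNIV. scale (m a) (letter a))"
proof -
  have inj: "inj (letter :: 'x \<Rightarrow> ('x, 'k) free_algebra)"
    by (simp add: inj_def letter_eq_word)
  obtain u where "f = (\<Sum>v\<in>range letter. scale (u v) v)"
    using assms by (auto simp: degree_one_def free_algebra.span_finite)
  then show ?thesis
    using that [of "\<lambda>a. u (letter a)"] inj by (simp add: sum.reindex)
qed

lemma degree_one_eq_sum_coeff:
  fixes f :: "('x::finite, 'k::field) free_algebra"
  assumes "f \<in> degree_one"
  shows "f = (\<Sum>a\<in>UNIV. scale (coeff f [a]) (letter a))"
proof -
  obtain m where m: "f = (\<Sum>a\<in>UNIV. scale (m a) (letter a))"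
    using degree_one_sum [OF assms] .
  have "coeff f [c] = m c" for c
  proof -
    have "coeff f [c] = (\<Sum>a\<in>UNIV. if a = c then m a else 0)"
      unfolding m lookup_sum by (rule sum.cong) (auto simp: letter_eq_word lookup_word)
    then show ?thesis
      by simp
  qed
  then show ?thesis
    using m by simp
qed

lemma length_support_mult:
  assumes "\<And>v. v \<in> support f \<Longrightarrow> length v = m" "\<And>v. v \<in> support g \<Longrightarrow> length v = n"
    and "v \<in> support (f * g)"
  shows "length v = m + n"
  using keys_mult [of f g] assms by (auto simp: plus_list_def)

lemma length_support_span:
  assumes "\<And>f v. f \<in> S \<Longrightarrow> v \<in> support f \<Longrightarrow> length v = n"
    and f: "f \<in> free_algebra.span S" "v \<in> support f"
  shows "length v = n"
proof -
  let ?H = "{f :: ('x, 'k::field) free_algebra. \<forall>v. length v \<noteq> n \<longrightarrow> coeff f v = 0}"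
  have "free_algebra.span S \<subseteq> ?H"
  proof (rule free_algebra.span_minimal)
    show "S \<subseteq> ?H"
      using assms(1) by (auto simp: in_keys_iff)
    show "free_algebra.subspace ?H"
      by (auto simp: free_algebra.subspace_def lookup_add)
  qed
  with f show ?thesis
    by (auto simp: in_keys_iff)
qed

lemma degree_one_length: "f \<in> degree_one \<Longrightarrow> v \<in> support f \<Longrightarrow> length v = 1"
  unfolding degree_one_def
  by (erule length_support_span [rotated])
    (auto simp: letter_eq_word in_keys_iff lookup_word split: if_splits)

lemma degree_two_length:
  fixes f :: "('x, 'k::field) free_algebra"
  assumes "f \<in> degree_two" "v \<in> support f"
  shows "length v = 2"
  using _ assms unfolding degree_two_def
proof (rule length_support_span)
  fix h :: "('x, 'k) free_algebra" and v
  assume "h \<in> {f * g |f g. f \<in> degree_one \<and> g \<in> degree_one}" "v \<in> support h"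
  then obtain a b :: "('x, 'k) free_algebra"
    where "a \<in> degree_one" "b \<in> degree_one" "v \<in> support (a * b)"
    by auto
  then have "length v = 1 + 1"
    by (intro length_support_mult [of a _ b] degree_one_length)
  then show "length v = 2"
    by simp
qed

lemma coeff_letter_mult: "coeff (letter a * f) (b # v) = (if a = b then coeff f v else 0)"
  by (induction f rule: words_induct)
    (auto simp: letter_eq_word lookup_word distrib_left scale_mult_right lookup_add)

lemma coeff_mult_letter: "coeff (f * letter a) (v @ [b]) = (if a = b then coeff f v else 0)"
  by (induction f rule: words_induct)
    (auto simp: letter_eq_word lookup_word distrib_right scale_mult_left lookup_add)

lemma coeff_mult_degree_one:
  fixes f g :: "('x::finite, 'k::field) free_algebra"
  assumes "f \<in> degree_one"
  shows "coeff (f * g) (c # w) = coeff f [c] * coeff g w"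
proof -
  obtain m where m: "f = (\<Sum>a\<in>UNIV. scale (m a) (letter a))"
    using degree_one_sum [OF assms] .
  have "coeff f [c] = (\<Sum>a\<in>UNIV. if a = c then m a else 0)"
    unfolding m lookup_sum by (rule sum.cong) (auto simp: letter_eq_word lookup_word)
  moreover have "coeff (f * g) (c # w) = (\<Sum>a\<in>UNIV. if a = c then m a * coeff g w else 0)"
    unfolding m sum_distrib_right scale_mult_left lookup_sum
    by (rule sum.cong) (auto simp: coeff_letter_mult)
  ultimately show ?thesis
    by simp
qed

lemma support_word_mult:
  assumes "x \<in> support (word u * f * word v)"
  shows "\<exists>y\<in>support f. x = u @ y @ v"
proof -
  have "word u * f * word v
      = word u * (\<Sum>y\<in>support f. scale (coeff f y) (word y)) * word v"
    by (simp only: sum_words)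
  also have "\<dots> = (\<Sum>y\<in>support f. scale (coeff f y) (word (u @ y @ v)))"
    by (simp add: sum_distrib_left sum_distrib_right scale_mult_left scale_mult_right)
  finally have "(\<Sum>y\<in>support f. coeff (scale (coeff f y) (word (u @ y @ v))) x) \<noteq> 0"
    using assms by (simp add: in_keys_iff lookup_sum)
  then obtain y where "y \<in> support f" "coeff (scale (coeff f y) (word (u @ y @ v))) x \<noteq> 0"
    by (rule sum.not_neutral_contains_not_neutral)
  then show ?thesis
    by (auto simp: lookup_word split: if_splits)
qed

lemma coeff_word_mult: "coeff (word u * f * word v) (u @ w @ v) = coeff f w"
proof -
  have "word u * f * word v
      = word u * (\<Sum>y\<in>support f. scale (coeff f y) (word y)) * word v"
    by (simp only: sum_words)
  also have "\<dots> = (\<Sum>y\<in>support f. scale (coeff f y) (word (u @ y @ v)))"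
    by (simp add: sum_distrib_left sum_distrib_right scale_mult_left scale_mult_right)
  also have "coeff \<dots> (u @ w @ v) = (\<Sum>y\<in>support f. if y = w then coeff f y else 0)"
    unfolding lookup_sum by (rule sum.cong) (auto simp: lookup_word)
  also have "\<dots> = coeff f w"
    by (simp add: in_keys_iff)
  finally show ?thesis .
qed


section \<open>Changing the letters\<close>

lemma algebra_hom_module_hom: "algebra_hom h \<Longrightarrow> module_hom scale scale h"
  by (rule Vector_Spaces.module_hom_linearI [OF algebra_hom_linear])

lemma algebra_hom_span:
  assumes "algebra_hom h"
  shows "free_algebra.span (h ` S) = h ` free_algebra.span S"
  by (rule module_hom.span_image [OF algebra_hom_module_hom [OF assms]])

lemma algebra_hom_independent:
  assumes "algebra_hom h" "inj_on h (free_algebra.span S)" "free_algebra.independent S"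
  shows "free_algebra.independent (h ` S)"
  by (rule module_hom.independent_injective_image [OF algebra_hom_module_hom [OF assms(1)]]) (use assms in auto)

lemma algebra_hom_linear_basis:
  assumes "algebra_hom h" "\<And>f. k (h f) = f" "linear_basis G R"
  shows "linear_basis (h ` G) (h ` R)"
proof -
  have "inj_on h S" for S
    by (rule inj_on_inverseI) (rule assms(2))
  then show ?thesis
    using assms(1,3) algebra_hom_independent
    by (auto simp: linear_basis_def algebra_hom_span)
qed

lemma algebra_hom_sum:
  assumes "algebra_hom h"
  shows "h (\<Sum>a\<in>A. f a) = (\<Sum>a\<in>A. h (f a))"
  by (rule module_hom.sum [OF algebra_hom_module_hom [OF assms]])

lemma algebra_hom_zero: "algebra_hom h \<Longrightarrow> h 0 = 0"
  using algebra_hom_scale [of h 0 0] by simp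

lemma algebra_hom_diff:
  assumes "algebra_hom h"
  shows "h (f - g) = h f - h g"
  using algebra_hom_add [OF assms, of "f - g" g] by simp

text \<open>
  \<open>\<phi>\<close> sends a word to the monomial that it spells in the new letters, and \<open>\<psi>\<close> expresses an element in
  the new letters.
\<close>

definition letter_change ::
  "(('x, 'k::field) free_algebra \<Rightarrow> ('x, 'k) free_algebra) \<Rightarrow>
   (('x, 'k) free_algebra \<Rightarrow> ('x, 'k) free_algebra) \<Rightarrow> bool" where
  "letter_change \<phi> \<psi> \<longleftrightarrow> algebra_hom \<phi> \<and> algebra_hom \<psi> \<and>
     (\<forall>f. \<phi> (\<psi> f) = f) \<and> (\<forall>f. \<psi> (\<phi> f) = f) \<and>
     (\<forall>a. \<phi> (letter a) \<in> degree_one) \<and> (\<forall>a. \<psi> (letter a) \<in> degree_one)"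

lemma algebra_hom_degree_one:
  assumes "algebra_hom h" "\<And>a. h (letter a) \<in> degree_one" "f \<in> degree_one"
  shows "h f \<in> degree_one"
proof -
  have "h ` free_algebra.span (range letter) \<subseteq> degree_one"
    unfolding algebra_hom_span [OF assms(1), symmetric]
    by (rule free_algebra.span_minimal) (use assms(2) in \<open>auto simp: degree_one_def\<close>)
  then show ?thesis
    using assms(3) by (auto simp: degree_one_def)
qed

text \<open>
  Any two bases of the space of letters are in bijection, so \<open>\<phi>\<close> can send letters to basis elements;
  \<open>\<psi>\<close> sends each letter to its expansion in the basis. That \<open>\<psi> \<circ> \<phi>\<close> is the identity as well follows
  because \<open>\<phi>\<close> is injective on linear forms.
\<close>

lemma letter_change_of_basis:
  fixes B :: "('x::finite, 'k::field) free_algebra set"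
  assumes "linear_basis B degree_one"
  obtains \<phi> \<psi> where "letter_change \<phi> \<psi>" "B = \<phi> ` range letter"
proof -
  have indep: "free_algebra.independent B" and span: "free_algebra.span B = degree_one"
    using assms by (auto simp: linear_basis_def)
  obtain f where f: "bij_betw f (range letter :: ('x, 'k) free_algebra set) B"
    using free_algebra.bij_if_span_eq_span_bases [OF independent_letters indep] span
    by (auto simp: degree_one_def)
  define b where "b a = f (letter a)" for a
  have b_range: "range b = B"
    using f by (auto simp: b_def bij_betw_def)
  have "inj (letter :: 'x \<Rightarrow> ('x, 'k) free_algebra)"
    by (simp add: inj_def letter_eq_word)
  then have b_inj: "inj b"
    using f by (auto simp: b_def [abs_def] bij_betw_def inj_on_def)
  have b_deg: "b a \<in> degree_one" for a
    using free_algebra.span_base [of "b a" B] b_range span by auto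
  have "\<exists>m. letter a = (\<Sum>x\<in>UNIV. scale (m x) (b x))" for a
  proof -
    have "letter a \<in> free_algebra.span (range b)"
      using b_range span by simp
    then obtain u where "letter a = (\<Sum>v\<in>range b. scale (u v) v)"
      by (auto simp: free_algebra.span_finite)
    then show ?thesis
      using b_inj by (intro exI [of _ "\<lambda>x. u (b x)"]) (simp add: sum.reindex)
  qed
  then obtain m where m: "\<And>a. letter a = (\<Sum>x\<in>UNIV. scale (m a x) (b x))"
    by metis
  define c :: "'x \<Rightarrow> ('x, 'k) free_algebra"
    where "c a = (\<Sum>x\<in>UNIV. scale (m a x) (letter x))" for a
  have c_deg: "c a \<in> degree_one" for a
    unfolding c_def degree_one_def
    by (intro free_algebra.span_sum free_algebra.span_scale free_algebra.span_base) auto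
  have hom: "algebra_hom (subst b)" "algebra_hom (subst c)"
    by (rule algebra_hom_subst)+
  have "subst b (c a) = letter a" for a
    unfolding m [of a] c_def
    by (simp add: algebra_hom_sum [OF hom(1)] algebra_hom_scale [OF hom(1)])
  then have bc: "subst b (subst c f) = f" for f
    using algebra_hom_eqI [of "\<lambda>f. subst b (subst c f)" "\<lambda>f. f"] hom
    by (simp add: algebra_hom_def)
  have inj_deg: "d = 0" if d: "d \<in> degree_one" "subst b d = 0" for d
  proof -
    obtain n where n: "d = (\<Sum>a\<in>UNIV. scale (n a) (letter a))"
      using degree_one_sum [OF d(1)] .
    have "0 = (\<Sum>a\<in>UNIV. scale (n a) (b a))"
      using d(2) by (simp add: n algebra_hom_sum [OF hom(1)] algebra_hom_scale [OF hom(1)])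
    also have "\<dots> = (\<Sum>v\<in>B. scale (n (inv b v)) v)"
      using b_inj by (simp add: b_range [symmetric] sum.reindex)
    finally have "n (inv b v) = 0" if "v \<in> B" for v
      using free_algebra.independentD [OF indep _ order_refl, of "\<lambda>v. n (inv b v)"] that
      by (metis b_range finite_UNIV finite_imageI)
    then have "n a = 0" for a
      using b_inj b_range by (metis inv_f_f rangeI)
    then show "d = 0"
      by (simp add: n)
  qed
  have "subst c (b a) = letter a" for a
  proof -
    have "subst c (b a) \<in> degree_one"
      by (rule algebra_hom_degree_one [OF hom(2)]) (simp_all add: c_deg b_deg)
    then have "subst c (b a) - letter a \<in> degree_one"
      by (simp add: degree_one_def free_algebra.span_diff free_algebra.span_base)
    moreover have "subst b (subst c (b a) - letter a) = 0"
      by (simp add: algebra_hom_diff [OF hom(1)] bc)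
    ultimately show ?thesis
      using inj_deg by fastforce
  qed
  then have cb: "subst c (subst b f) = f" for f
    using algebra_hom_eqI [of "\<lambda>f. subst c (subst b f)" "\<lambda>f. f"] hom
    by (simp add: algebra_hom_def)
  have "letter_change (subst b) (subst c)"
    by (simp add: letter_change_def hom bc cb b_deg c_deg)
  moreover have "B = subst b ` range letter"
    by (simp add: image_image b_range)
  ultimately show ?thesis
    using that by blast
qed

lemma letter_change_basis:
  fixes \<phi> :: "('x, 'k::field) free_algebra \<Rightarrow> _"
  assumes "letter_change \<phi> \<psi>"
  shows "linear_basis (\<phi> ` range letter) degree_one"
proof -
  have hom: "algebra_hom \<phi>" "algebra_hom \<psi>" and inv: "\<And>f. \<phi> (\<psi> f) = f" "\<And>f. \<psi> (\<phi> f) = f"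
    and deg: "\<And>a. \<phi> (letter a) \<in> degree_one" "\<And>a. \<psi> (letter a) \<in> degree_one"
    using assms by (auto simp: letter_change_def)
  have "inj \<phi>"
    using inv by (metis injI)
  then have "free_algebra.independent (\<phi> ` range letter)"
    by (intro algebra_hom_independent hom independent_letters) (auto intro: inj_on_subset)
  moreover have "\<phi> ` degree_one = degree_one"
  proof
    show "\<phi> ` degree_one \<subseteq> degree_one"
      using algebra_hom_degree_one [OF hom(1) deg(1)] by blast
    show "degree_one \<subseteq> \<phi> ` degree_one"
    proof
      fix f :: "('x, 'k) free_algebra" assume "f \<in> degree_one"
      then have "\<psi> f \<in> degree_one"
        by (rule algebra_hom_degree_one [OF hom(2) deg(2)])
      then show "f \<in> \<phi> ` degree_one"
        using inv(1) [of f] by (intro image_eqI [of _ _ "\<psi> f"]) auto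
    qed
  qed
  then have "free_algebra.span (\<phi> ` range letter) = degree_one"
    unfolding algebra_hom_span [OF hom(1)] by (simp add: degree_one_def)
  ultimately show ?thesis
    by (simp add: linear_basis_def)
qed

lemma letter_changeI:
  assumes "\<And>a. subst b (c a) = letter a" "\<And>a. subst c (b a) = letter a"
    and "\<And>a. b a \<in> degree_one" "\<And>a. c a \<in> degree_one"
  shows "letter_change (subst b) (subst c)"
proof -
  have "subst b (subst c f) = f" for f
    using algebra_hom_eqI [of "\<lambda>f. subst b (subst c f)" "\<lambda>f. f"] algebra_hom_subst [of b]
      algebra_hom_subst [of c] assms(1)
    by (simp add: algebra_hom_def)
  moreover have "subst c (subst b f) = f" for f
    using algebra_hom_eqI [of "\<lambda>f. subst c (subst b f)" "\<lambda>f. f"] algebra_hom_subst [of b]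
      algebra_hom_subst [of c] assms(2)
    by (simp add: algebra_hom_def)
  ultimately show ?thesis
    using assms by (simp add: letter_change_def algebra_hom_subst)
qed

lemma letter_change_flip: "letter_change \<phi> \<psi> \<Longrightarrow> letter_change \<psi> \<phi>"
  by (simp add: letter_change_def)

text \<open>
  The matrices of \<open>\<phi>\<close> and \<open>\<psi>\<close> on the letters are inverse to each other.
\<close>

lemma letter_change_matrix:
  fixes \<phi> \<psi> :: "('x::finite, 'k::field) free_algebra \<Rightarrow> ('x, 'k) free_algebra"
  assumes "letter_change \<phi> \<psi>"
  shows "(\<Sum>a\<in>UNIV. coeff (\<phi> (letter c)) [a] * coeff (\<psi> (letter a)) [d]) = (if c = d then 1 else 0)"
proof -
  have hom: "algebra_hom \<psi>" and "\<phi> (letter c) \<in> degree_one" and inv: "\<psi> (\<phi> (letter c)) = letter c"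
    using assms by (auto simp: letter_change_def)
  then have "letter c = \<psi> (\<Sum>a\<in>UNIV. scale (coeff (\<phi> (letter c)) [a]) (letter a))"
    by (simp flip: degree_one_eq_sum_coeff)
  then have eq: "letter c = (\<Sum>a\<in>UNIV. scale (coeff (\<phi> (letter c)) [a]) (\<psi> (letter a)))"
    by (simp add: algebra_hom_sum [OF hom] algebra_hom_scale [OF hom])
  have "coeff (letter c) [d] = (\<Sum>a\<in>UNIV. coeff (\<phi> (letter c)) [a] * coeff (\<psi> (letter a)) [d])"
    using arg_cong [OF eq, of "\<lambda>f. coeff f [d]"] by (simp add: lookup_sum)
  then show ?thesis
    by (simp add: letter_eq_word lookup_word)
qed

lemma two_sided_ideal_hull: "two_sided_ideal (two_sided_ideal hull S)"
  by (rule hull_in) (auto simp: two_sided_ideal_def)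

lemma algebra_iso_ideal:
  assumes hom: "algebra_hom \<phi>" "algebra_hom \<psi>"
    and inv: "\<And>f. \<phi> (\<psi> f) = f" "\<And>f. \<psi> (\<phi> f) = f"
  shows "two_sided_ideal hull (\<psi> ` S) = \<psi> ` (two_sided_ideal hull S)"
proof -
  have image: "two_sided_ideal (h ` I)"
    if h: "algebra_hom h" "\<And>f. h (k f) = f" and I: "two_sided_ideal I" for h k I
  proof -
    have "0 \<in> h ` I"
      using I algebra_hom_zero [OF h(1)] by (force simp: two_sided_ideal_def)
    moreover have "h f + h g \<in> h ` I" if "f \<in> I" "g \<in> I" for f g
      using I that unfolding algebra_hom_add [OF h(1), symmetric] by (simp add: two_sided_ideal_def)
    moreover have "a * h f \<in> h ` I \<and> h f * a \<in> h ` I" if "f \<in> I" for a f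
    proof -
      have "a * h f = h (k a * f)" "h f * a = h (f * k a)"
        by (simp_all add: algebra_hom_mult [OF h(1)] h(2))
      then show ?thesis
        using I that by (simp add: two_sided_ideal_def)
    qed
    ultimately show ?thesis
      by (auto simp: two_sided_ideal_def)
  qed
  have "two_sided_ideal hull (\<psi> ` S) \<subseteq> \<psi> ` (two_sided_ideal hull S)"
    by (intro hull_minimal image_mono hull_subset image [OF hom(2) inv(2)] two_sided_ideal_hull)
  moreover have "two_sided_ideal hull S \<subseteq> \<phi> ` (two_sided_ideal hull (\<psi> ` S))"
  proof (intro hull_minimal image [OF hom(1) inv(1)] two_sided_ideal_hull subsetI)
    fix s assume "s \<in> S"
    then have "\<psi> s \<in> two_sided_ideal hull (\<psi> ` S)"
      by (auto intro: hull_inc)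
    then show "s \<in> \<phi> ` (two_sided_ideal hull (\<psi> ` S))"
      using inv(1) by (metis image_eqI)
  qed
  then have "\<psi> ` (two_sided_ideal hull S) \<subseteq> two_sided_ideal hull (\<psi> ` S)"
    using inv(2) by force
  ultimately show ?thesis
    by blast
qed


section \<open>Leading words\<close>

definition word_order :: "'x list rel \<Rightarrow> bool" where
  "word_order le \<longleftrightarrow> well_order_on UNIV le \<and>
     (\<forall>(u, v) \<in> le. \<forall>w. (w @ u, w @ v) \<in> le \<and> (u @ w, v @ w) \<in> le)"

definition leading_word :: "'x list rel \<Rightarrow> ('x, 'k::field) free_algebra \<Rightarrow> 'x list" where
  "leading_word le f = (THE w. w \<in> support f \<and> (\<forall>v\<in>support f. (v, w) \<in> le))"

lemma
  assumes "word_order le"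
  shows word_order_refl: "(u, u) \<in> le"
    and word_order_antisym: "(u, v) \<in> le \<Longrightarrow> (v, u) \<in> le \<Longrightarrow> u = v"
    and word_order_trans: "(u, v) \<in> le \<Longrightarrow> (v, w) \<in> le \<Longrightarrow> (u, w) \<in> le"
    and word_order_total: "(u, v) \<in> le \<or> (v, u) \<in> le"
    and word_order_append_left: "(u, v) \<in> le \<Longrightarrow> (w @ u, w @ v) \<in> le"
    and word_order_append_right: "(u, v) \<in> le \<Longrightarrow> (u @ w, v @ w) \<in> le"
    and word_order_wf: "wf (le - Id)"
proof -
  have wo: "refl le" "antisym le" "trans le" "total le" "wf (le - Id)"
    using assms by (auto simp: word_order_def well_order_on_def linear_order_on_def
        partial_order_on_def preorder_on_def)
  show "(u, u) \<in> le"
    using wo(1) by (rule refl_onD) simp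
  then show "(u, v) \<in> le \<or> (v, u) \<in> le"
    using wo(4) by (cases "u = v") (auto simp: total_on_def)
  show "(u, v) \<in> le \<Longrightarrow> (v, u) \<in> le \<Longrightarrow> u = v"
    using wo(2) by (rule antisymD)
  show "(u, v) \<in> le \<Longrightarrow> (v, w) \<in> le \<Longrightarrow> (u, w) \<in> le"
    using wo(3) by (rule transD)
  show "wf (le - Id)"
    by (rule wo(5))
  show "(u, v) \<in> le \<Longrightarrow> (w @ u, w @ v) \<in> le" "(u, v) \<in> le \<Longrightarrow> (u @ w, v @ w) \<in> le"
    using assms unfolding word_order_def by blast+
qed

lemma leading_word_eqI:
  assumes "word_order le" "w \<in> support f" "\<And>v. v \<in> support f \<Longrightarrow> (v, w) \<in> le"
  shows "leading_word le f = w"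
  unfolding leading_word_def
  by (rule the_equality) (use assms word_order_antisym in blast)+

lemma word_order_finite_max:
  assumes "word_order le" "finite S" "S \<noteq> {}"
  shows "\<exists>w\<in>S. \<forall>v\<in>S. (v, w) \<in> le"
  using assms(2,3)
proof (induction rule: finite_ne_induct)
  case (singleton x)
  then show ?case
    using word_order_refl [OF assms(1)] by simp
next
  case (insert x F)
  then show ?case
    using word_order_total [OF assms(1)] word_order_trans [OF assms(1)] word_order_refl [OF assms(1)]
    by (metis insertE insertI1 insertI2)
qed

lemma
  assumes "word_order le" "f \<noteq> 0"
  shows leading_word_in_support: "leading_word le f \<in> support f"
    and leading_word_max: "v \<in> support f \<Longrightarrow> (v, leading_word le f) \<in> le"
proof -
  obtain w where "w \<in> support f" "\<forall>v\<in>support f. (v, w) \<in> le"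
    using word_order_finite_max [OF assms(1), of "support f"] assms(2) by auto
  moreover from this have "leading_word le f = w"
    by (intro leading_word_eqI assms(1)) auto
  ultimately show "leading_word le f \<in> support f"
    "v \<in> support f \<Longrightarrow> (v, leading_word le f) \<in> le"
    by auto
qed


section \<open>Groebner bases of words\<close>

definition word_groebner ::
  "'x list rel \<Rightarrow> ('x, 'k::field) free_algebra set \<Rightarrow> ('x, 'k) free_algebra set \<Rightarrow> bool" where
  "word_groebner le G I \<longleftrightarrow>
     (\<forall>f \<in> I - {0}. \<exists>g \<in> G - {0}. \<exists>u v. leading_word le f = u @ leading_word le g @ v)"

lemma well_order_on_dir_image:
  assumes "well_order_on A r" "inj_on f A"
  shows "well_order_on (f ` A) (dir_image r f)"
proof -
  have A: "A = Field r"
    using assms(1) well_order_on_Field by blast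
  then have "Well_order (dir_image r f)"
    using assms Well_order_dir_image by blast
  then show ?thesis
    by (simp add: dir_image_Field A)
qed

lemma letter_change_representation:
  fixes \<phi> :: "('x, 'k::field) free_algebra \<Rightarrow> ('x, 'k) free_algebra"
  assumes "letter_change \<phi> \<psi>"
  shows "free_algebra.representation (\<phi> ` range word) f (\<phi> (word w)) = coeff (\<psi> f) w"
proof -
  have hom: "algebra_hom \<phi>" "algebra_hom \<psi>" and inv: "\<And>f. \<phi> (\<psi> f) = f" "\<And>f. \<psi> (\<phi> f) = f"
    using assms by (auto simp: letter_change_def)
  have inj: "inj \<phi>"
    using inv by (metis injI)
  have span: "free_algebra.span (\<phi> ` range word) = UNIV"
    using inv by (simp add: algebra_hom_span [OF hom(1)] span_words surj_def) metis
  define c where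
    "c m = (if m \<in> \<phi> ` word ` support (\<psi> f) then coeff (\<psi> f) (inv word (\<psi> m)) else 0)" for m
  have inj_word: "inj (word :: 'x list \<Rightarrow> ('x, 'k) free_algebra)"
    by (simp add: inj_def)
  have c_word: "c (\<phi> (word w)) = coeff (\<psi> f) w" for w
    using inj_word inj by (auto simp: c_def inv inj_eq in_keys_iff inv_f_f)
  have c_supp: "{m. c m \<noteq> 0} = \<phi> ` word ` support (\<psi> f)"
  proof -
    have "c m \<noteq> 0" if "m \<in> \<phi> ` word ` support (\<psi> f)" for m
      using that by (auto simp: c_word in_keys_iff)
    moreover have "c m = 0" if "m \<notin> \<phi> ` word ` support (\<psi> f)" for m
      using that by (simp add: c_def)
    ultimately show ?thesis
      by blast
  qed
  have "free_algebra.representation (\<phi> ` range word) f = c"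
  proof (rule free_algebra.representation_eqI)
    show "free_algebra.independent (\<phi> ` range word)"
      by (intro algebra_hom_independent hom independent_words) (use inj inj_on_subset in auto)
    show "f \<in> free_algebra.span (\<phi> ` range word)"
      by (simp add: span)
    show "m \<in> \<phi> ` range word" if "c m \<noteq> 0" for m
      using that c_supp by blast
    show "finite {m. c m \<noteq> 0}"
      by (simp add: c_supp)
    have "inj_on (\<lambda>w. \<phi> (word w)) S" for S
      by (rule inj_onI) (simp add: inj_eq [OF inj])
    then have "(\<Sum>m | c m \<noteq> 0. scale (c m) m)
        = (\<Sum>w\<in>support (\<psi> f). scale (coeff (\<psi> f) w) (\<phi> (word w)))"
      unfolding c_supp image_image by (simp add: sum.reindex c_word)
    also have "\<dots> = \<phi> (\<Sum>w\<in>support (\<psi> f). scale (coeff (\<psi> f) w) (word w))"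
      by (simp add: algebra_hom_sum [OF hom(1)] algebra_hom_scale [OF hom(1)])
    also have "\<dots> = f"
      by (simp add: sum_words inv)
    finally show "(\<Sum>m | c m \<noteq> 0. scale (c m) m) = f" .
  qed
  then show ?thesis
    by (simp add: c_word)
qed

lemma letter_change_inj_word:
  assumes "letter_change \<phi> \<psi>"
  shows "inj (\<lambda>w. \<phi> (word w))"
proof (rule injI)
  fix u v
  assume "\<phi> (word u) = \<phi> (word v)"
  then have "\<psi> (\<phi> (word u)) = \<psi> (\<phi> (word v))"
    by simp
  then show "u = v"
    using assms by (simp add: letter_change_def)
qed

lemma monomials_letter_change:
  assumes "algebra_hom \<phi>"
  shows "monomials (\<phi> ` range letter) = \<phi> ` range word"
proof -
  have "prod_list (map \<phi> (map letter w)) = \<phi> (word w)" for w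
    by (simp add: algebra_hom_word [OF assms] comp_def)
  moreover have "lists (\<phi> ` range letter) = range (\<lambda>w. map \<phi> (map letter w))"
    by (simp add: lists_image image_image comp_def)
  ultimately show ?thesis
    by (simp add: monomials_def image_image)
qed

lemma groebner_basis_letter_change:
  assumes change: "letter_change \<phi> \<psi>" and order: "word_order le"
    and le: "\<And>u v. (u, v) \<in> le \<longleftrightarrow> (\<phi> (word u), \<phi> (word v)) \<in> r"
  shows "groebner_basis (\<phi> ` range letter) r G I \<longleftrightarrow>
    G \<subseteq> I \<and> word_groebner le (\<psi> ` G) (\<psi> ` I)"
proof -
  have hom: "algebra_hom \<phi>" "algebra_hom \<psi>" and inv: "\<And>f. \<phi> (\<psi> f) = f" "\<And>f. \<psi> (\<phi> f) = f"
    using change by (auto simp: letter_change_def)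
  have zero: "\<psi> f = 0 \<longleftrightarrow> f = 0" for f
    using inv(1) [of f] algebra_hom_zero [OF hom(1)] algebra_hom_zero [OF hom(2)] by auto
  have mon: "monomials (\<phi> ` range letter) = \<phi> ` range word"
    by (rule monomials_letter_change [OF hom(1)])
  have supp: "monomial_support (\<phi> ` range letter) f = (\<lambda>w. \<phi> (word w)) ` support (\<psi> f)" for f
  proof -
    have "free_algebra.representation (\<phi> ` range word) f m \<noteq> 0 \<longleftrightarrow>
        m \<in> (\<lambda>w. \<phi> (word w)) ` support (\<psi> f)" for m
    proof
      assume nz: "free_algebra.representation (\<phi> ` range word) f m \<noteq> 0"
      then obtain w where "m = \<phi> (word w)"
        using free_algebra.representation_ne_zero by blast
      then show "m \<in> (\<lambda>w. \<phi> (word w)) ` support (\<psi> f)"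
        using nz by (simp add: letter_change_representation [OF change] in_keys_iff)
    qed (auto simp: letter_change_representation [OF change] in_keys_iff)
    then show ?thesis
      by (auto simp: monomial_support_def mon)
  qed
  have lead: "leading_monomial (\<phi> ` range letter) r f = \<phi> (word (leading_word le (\<psi> f)))"
    if "f \<noteq> 0" for f
    unfolding leading_monomial_def supp
  proof (rule the_equality)
    have nz: "\<psi> f \<noteq> 0"
      using that zero by simp
    show max: "\<phi> (word (leading_word le (\<psi> f))) \<in> (\<lambda>w. \<phi> (word w)) ` support (\<psi> f) \<and>
      (\<forall>m'\<in>(\<lambda>w. \<phi> (word w)) ` support (\<psi> f). (m', \<phi> (word (leading_word le (\<psi> f)))) \<in> r)"
      using leading_word_in_support [OF order nz] leading_word_max [OF order nz]
      by (auto simp: le [symmetric])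
    fix m
    assume m: "m \<in> (\<lambda>w. \<phi> (word w)) ` support (\<psi> f) \<and>
      (\<forall>m'\<in>(\<lambda>w. \<phi> (word w)) ` support (\<psi> f). (m', m) \<in> r)"
    then obtain w where w: "w \<in> support (\<psi> f)" "m = \<phi> (word w)"
      by blast
    with m have "leading_word le (\<psi> f) = w"
      by (intro leading_word_eqI [OF order]) (auto simp: le)
    then show "m = \<phi> (word (leading_word le (\<psi> f)))"
      by (simp add: w)
  qed
  have mult: "\<phi> (word u) * \<phi> (word v) = \<phi> (word (u @ v))" for u v
    by (simp add: algebra_hom_mult [OF hom(1), symmetric])
  have inj: "\<phi> (word u) = \<phi> (word v) \<longleftrightarrow> u = v" for u v
    using inj_eq [OF letter_change_inj_word [OF change]] .
  show ?thesis
    unfolding groebner_basis_def word_groebner_def mon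
    by (auto simp: Ball_def Bex_def lead zero mult inj)
qed

text \<open>Once the new letters are renamed to the given ones, a monomial is simply a word and a leading
  monomial is a leading word.\<close>

lemma PBW_iff:
  "PBW R \<longleftrightarrow> (\<exists>\<phi> \<psi> le G. letter_change \<phi> \<psi> \<and> word_order le \<and> linear_basis G (\<psi> ` R) \<and>
     word_groebner le G (two_sided_ideal hull (\<psi> ` R)))"
  (is "_ \<longleftrightarrow> ?words")
proof
  assume "PBW R"
  then obtain B G r where B: "linear_basis B degree_one" and G: "linear_basis G R"
    and r: "monomial_order B r" and gb: "groebner_basis B r G (two_sided_ideal hull R)"
    unfolding PBW_def by blast
  obtain \<phi> \<psi> where change: "letter_change \<phi> \<psi>" and B_eq: "B = \<phi> ` range letter"
    using letter_change_of_basis [OF B] .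
  have hom: "algebra_hom \<phi>" "algebra_hom \<psi>" and inv: "\<And>f. \<phi> (\<psi> f) = f" "\<And>f. \<psi> (\<phi> f) = f"
    using change by (auto simp: letter_change_def)
  have mon: "monomials B = range (\<lambda>w. \<phi> (word w))"
    unfolding B_eq monomials_letter_change [OF hom(1)] by (rule image_image)
  have inj: "inj (\<lambda>w. \<phi> (word w))"
    by (rule letter_change_inj_word [OF change])
  have mult: "\<phi> (word (u @ v)) = \<phi> (word u) * \<phi> (word v)" for u v
    by (simp add: algebra_hom_mult [OF hom(1), symmetric])
  define e where "e = inv (\<lambda>w. \<phi> (word w))"
  define le where "le = dir_image r e"
  have e: "e (\<phi> (word w)) = w" for w
    unfolding e_def by (rule inv_f_f [OF inj])
  have wo: "well_order_on (range (\<lambda>w. \<phi> (word w))) r"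
    and compat: "\<And>u v w. (u, v) \<in> r \<Longrightarrow> w \<in> range (\<lambda>w. \<phi> (word w)) \<Longrightarrow>
        (w * u, w * v) \<in> r \<and> (u * w, v * w) \<in> r"
    using r unfolding monomial_order_def mon by blast+
  have r_mon: "u \<in> range (\<lambda>w. \<phi> (word w)) \<and> v \<in> range (\<lambda>w. \<phi> (word w))" if "(u, v) \<in> r" for u v
    using that well_order_on_Field [OF wo] by (auto simp: Field_def)
  have le_iff: "(u, v) \<in> le \<longleftrightarrow> (\<phi> (word u), \<phi> (word v)) \<in> r" for u v
  proof
    assume "(u, v) \<in> le"
    then obtain a b where ab: "(a, b) \<in> r" "u = e a" "v = e b"
      by (auto simp: le_def dir_image_def)
    then obtain x y where "a = \<phi> (word x)" "b = \<phi> (word y)"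
      using r_mon by blast
    with ab show "(\<phi> (word u), \<phi> (word v)) \<in> r"
      by (simp add: e)
  next
    assume "(\<phi> (word u), \<phi> (word v)) \<in> r"
    then have "(e (\<phi> (word u)), e (\<phi> (word v))) \<in> le"
      unfolding le_def dir_image_def by blast
    then show "(u, v) \<in> le"
      by (simp add: e)
  qed
  have "well_order_on (e ` range (\<lambda>w. \<phi> (word w))) le"
    unfolding le_def by (rule well_order_on_dir_image [OF wo]) (auto simp: inj_on_def e)
  then have order: "word_order le"
    using compat by (auto simp: word_order_def image_image e le_iff mult)
  have "linear_basis (\<psi> ` G) (\<psi> ` R)"
    by (rule algebra_hom_linear_basis [OF hom(2) inv(1) G])
  moreover have "word_groebner le (\<psi> ` G) (two_sided_ideal hull (\<psi> ` R))"
    using gb unfolding B_eq groebner_basis_letter_change [OF change order le_iff]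
      algebra_iso_ideal [OF hom inv] by simp
  ultimately show ?words
    using change order by blast
next
  assume ?words
  then obtain \<phi> \<psi> le G where change: "letter_change \<phi> \<psi>" and order: "word_order le"
    and G: "linear_basis G (\<psi> ` R)" and gb: "word_groebner le G (two_sided_ideal hull (\<psi> ` R))"
    by blast
  have hom: "algebra_hom \<phi>" "algebra_hom \<psi>" and inv: "\<And>f. \<phi> (\<psi> f) = f" "\<And>f. \<psi> (\<phi> f) = f"
    using change by (auto simp: letter_change_def)
  have mon: "monomials (\<phi> ` range letter) = range (\<lambda>w. \<phi> (word w))"
    unfolding monomials_letter_change [OF hom(1)] by (rule image_image)
  have inj: "inj (\<lambda>w. \<phi> (word w))"
    by (rule letter_change_inj_word [OF change])
  have mult: "\<phi> (word u) * \<phi> (word v) = \<phi> (word (u @ v))" for u v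
    by (simp add: algebra_hom_mult [OF hom(1), symmetric])
  define r where "r = dir_image le (\<lambda>w. \<phi> (word w))"
  have r_iff: "(u, v) \<in> le \<longleftrightarrow> (\<phi> (word u), \<phi> (word v)) \<in> r" for u v
    using inj by (auto simp: r_def dir_image_def inj_def)
  have "well_order_on (range (\<lambda>w. \<phi> (word w))) r"
    unfolding r_def by (rule well_order_on_dir_image) (use order inj in \<open>auto simp: word_order_def\<close>)
  moreover have "\<exists>x y. u = \<phi> (word x) \<and> v = \<phi> (word y) \<and> (x, y) \<in> le" if "(u, v) \<in> r" for u v
    using that by (auto simp: r_def dir_image_def)
  then have "(w * u, w * v) \<in> r \<and> (u * w, v * w) \<in> r"
    if "(u, v) \<in> r" "w \<in> range (\<lambda>w. \<phi> (word w))" for u v w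
    using that word_order_append_left [OF order] word_order_append_right [OF order]
    by (fastforce simp: mult r_iff [symmetric])
  ultimately have "monomial_order (\<phi> ` range letter) r"
    unfolding monomial_order_def mon by blast
  moreover have "linear_basis (\<phi> ` G) R"
  proof -
    have "\<phi> ` \<psi> ` R = R"
      by (simp add: image_image inv)
    then show ?thesis
      using algebra_hom_linear_basis [OF hom(1) inv(2) G] by simp
  qed
  moreover from this have "\<phi> ` G \<subseteq> two_sided_ideal hull R"
    unfolding linear_basis_def
    by (metis free_algebra.span_superset hull_subset subset_trans)
  then have "groebner_basis (\<phi> ` range letter) r (\<phi> ` G) (two_sided_ideal hull R)"
    unfolding groebner_basis_letter_change [OF change order r_iff]
    using gb by (simp add: algebra_iso_ideal [OF hom inv] image_image inv)
  ultimately show "PBW R"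
    unfolding PBW_def using letter_change_basis [OF change] by blast
qed


section \<open>The diamond lemma for quadratic rewriting rules\<close>

text \<open>
  The predicate restricts the words at which a rule may be applied. Bounding them by a word gives the
  filtration of the ideal on which the diamond lemma rests.
\<close>

definition rule_span ::
  "'x list set \<Rightarrow> ('x list \<Rightarrow> ('x, 'k::field) free_algebra) \<Rightarrow> ('x list \<Rightarrow> bool) \<Rightarrow>
     ('x, 'k) free_algebra set" where
  "rule_span M \<gamma> P =
     free_algebra.span {word u * \<gamma> m * word v | u m v. m \<in> M \<and> P (u @ m @ v)}"

lemma rule_spanI: "m \<in> M \<Longrightarrow> P (u @ m @ v) \<Longrightarrow> word u * \<gamma> m * word v \<in> rule_span M \<gamma> P"
  unfolding rule_span_def by (rule free_algebra.span_base) blast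

lemma rule_span_mono:
  "f \<in> rule_span M \<gamma> P \<Longrightarrow> (\<And>w. P w \<Longrightarrow> Q w) \<Longrightarrow> f \<in> rule_span M \<gamma> Q"
  unfolding rule_span_def by (rule subsetD [OF free_algebra.span_mono]) auto

lemma rule_span_minimal:
  assumes "f \<in> rule_span M \<gamma> P" "free_algebra.subspace S"
    and "\<And>u m v. m \<in> M \<Longrightarrow> P (u @ m @ v) \<Longrightarrow> word u * \<gamma> m * word v \<in> S"
  shows "f \<in> S"
proof -
  have "{word u * \<gamma> m * word v | u m v. m \<in> M \<and> P (u @ m @ v)} \<subseteq> S"
    using assms(3) by auto
  from subsetD [OF free_algebra.span_minimal [OF this assms(2)]] show ?thesis
    using assms(1) unfolding rule_span_def .
qed

lemma rule_span_subspace: "free_algebra.subspace (rule_span M \<gamma> P)"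
  by (simp add: rule_span_def)

lemmas rule_span_add = free_algebra.subspace_add [OF rule_span_subspace]
  and rule_span_diff = free_algebra.subspace_diff [OF rule_span_subspace]
  and rule_span_scale = free_algebra.subspace_scale [OF rule_span_subspace]
  and rule_span_zero = free_algebra.subspace_0 [OF rule_span_subspace]
  and rule_span_neg = free_algebra.subspace_neg [OF rule_span_subspace]
  and rule_span_sum = free_algebra.subspace_sum [OF rule_span_subspace]

lemma rule_span_mult:
  assumes "f \<in> rule_span M \<gamma> P" "\<And>w. P w \<Longrightarrow> Q (s @ w @ t)"
  shows "word s * f * word t \<in> rule_span M \<gamma> Q"
proof -
  have "f \<in> {f. word s * f * word t \<in> rule_span M \<gamma> Q}"
    using assms(1)
  proof (rule rule_span_minimal)
    show "free_algebra.subspace {f. word s * f * word t \<in> rule_span M \<gamma> Q}"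
      by (auto simp: free_algebra.subspace_def distrib_left distrib_right scale_mult_left
          scale_mult_right intro: rule_span_zero rule_span_add rule_span_scale)
    fix u m v
    assume "m \<in> M" "P (u @ m @ v)"
    then have "word (s @ u) * \<gamma> m * word (v @ t) \<in> rule_span M \<gamma> Q"
      using assms(2) [of "u @ m @ v"] by (intro rule_spanI) auto
    then show "word u * \<gamma> m * word v \<in> {f. word s * f * word t \<in> rule_span M \<gamma> Q}"
      by (simp add: mult.assoc flip: word_mult)
  qed
  then show ?thesis
    by simp
qed

text \<open>
  The rule \<open>\<gamma> m\<close> rewrites its leading word \<open>m\<close> to \<open>m - \<gamma> m\<close>.
\<close>

locale quadratic_rules =
  fixes le :: "'x list rel" and M :: "'x list set"
    and \<gamma> :: "'x list \<Rightarrow> ('x, 'k::field) free_algebra"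
  assumes order: "word_order le"
    and rule_length: "m \<in> M \<Longrightarrow> length m = 2"
    and rule_monic: "m \<in> M \<Longrightarrow> coeff (\<gamma> m) m = 1"
    and rule_lead: "m \<in> M \<Longrightarrow> w \<in> support (\<gamma> m) \<Longrightarrow> (w, m) \<in> le"
begin

definition below :: "'x list \<Rightarrow> ('x, 'k) free_algebra set" where
  "below w = rule_span M \<gamma> (\<lambda>v. (v, w) \<in> le - Id)"

lemma below_mult:
  assumes "f \<in> below w"
  shows "word s * f * word t \<in> below (s @ w @ t)"
  using assms unfolding below_def
proof (rule rule_span_mult)
  fix v assume "(v, w) \<in> le - Id"
  then show "(s @ v @ t, s @ w @ t) \<in> le - Id"
    using word_order_append_left [OF order] word_order_append_right [OF order] by auto
qed

lemma rule_nonzero: "m \<in> M \<Longrightarrow> \<gamma> m \<noteq> 0"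
  using rule_monic by fastforce

lemma leading_word_rule: "m \<in> M \<Longrightarrow> leading_word le (\<gamma> m) = m"
  by (rule leading_word_eqI [OF order]) (auto simp: in_keys_iff rule_monic rule_lead)

text \<open>
  Both \<open>\<gamma> m t n\<close> and \<open>m t \<gamma> n\<close> differ from \<open>\<gamma> m t \<gamma> n\<close> by elements in which one rule is applied next to a
  word of the lower part \<open>\<gamma> n - n\<close> or \<open>\<gamma> m - m\<close> of the other.
\<close>

lemma disjoint_rules_resolve:
  assumes m: "m \<in> M" and n: "n \<in> M"
  shows "\<gamma> m * word (t @ n) - word (m @ t) * \<gamma> n \<in> below (m @ t @ n)"
proof -
  have tail_less: "(x, k) \<in> le - Id"
    if k: "k \<in> M" and x: "x \<in> support (\<gamma> k - word k)" for k x
  proof -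
    have "x \<noteq> k"
      using x k by (auto simp: in_keys_iff lookup_minus lookup_word rule_monic)
    moreover from this have "x \<in> support (\<gamma> k)"
      using x by (auto simp: in_keys_iff lookup_minus lookup_word)
    ultimately show ?thesis
      using rule_lead [OF k] by auto
  qed
  have right: "\<gamma> m * word t * (\<gamma> n - word n) \<in> below (m @ t @ n)"
  proof -
    have "word [] * \<gamma> m * word (t @ x) \<in> below (m @ t @ n)"
      if "x \<in> support (\<gamma> n - word n)" for x
      unfolding below_def
      using tail_less [OF n that] word_order_append_left [OF order, of x n "m @ t"]
      by (intro rule_spanI m) auto
    then have "(\<Sum>x\<in>support (\<gamma> n - word n). scale (coeff (\<gamma> n - word n) x)
        (word [] * \<gamma> m * word (t @ x))) \<in> below (m @ t @ n)"
      unfolding below_def by (intro rule_span_sum rule_span_scale)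
    also have "(\<Sum>x\<in>support (\<gamma> n - word n). scale (coeff (\<gamma> n - word n) x)
        (word [] * \<gamma> m * word (t @ x)))
        = \<gamma> m * word t * (\<Sum>x\<in>support (\<gamma> n - word n). scale (coeff (\<gamma> n - word n) x) (word x))"
      by (simp add: sum_distrib_left scale_mult_right mult.assoc)
    finally show ?thesis
      by (simp only: sum_words)
  qed
  have left: "(\<gamma> m - word m) * word t * \<gamma> n \<in> below (m @ t @ n)"
  proof -
    have "word (x @ t) * \<gamma> n * word [] \<in> below (m @ t @ n)"
      if "x \<in> support (\<gamma> m - word m)" for x
      unfolding below_def
      using tail_less [OF m that] word_order_append_right [OF order, of x m "t @ n"]
      by (intro rule_spanI n) auto
    then have "(\<Sum>x\<in>support (\<gamma> m - word m). scale (coeff (\<gamma> m - word m) x)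
        (word (x @ t) * \<gamma> n * word [])) \<in> below (m @ t @ n)"
      unfolding below_def by (intro rule_span_sum rule_span_scale)
    also have "(\<Sum>x\<in>support (\<gamma> m - word m). scale (coeff (\<gamma> m - word m) x)
        (word (x @ t) * \<gamma> n * word []))
        = (\<Sum>x\<in>support (\<gamma> m - word m). scale (coeff (\<gamma> m - word m) x) (word x)) * word t * \<gamma> n"
      by (simp add: sum_distrib_right scale_mult_left flip: word_mult)
    finally show ?thesis
      by (simp only: sum_words)
  qed
  have "\<gamma> m * word (t @ n) - word (m @ t) * \<gamma> n
      = (\<gamma> m - word m) * word t * \<gamma> n - \<gamma> m * word t * (\<gamma> n - word n)"
    by (simp add: algebra_simps flip: word_mult)
  then show ?thesis
    using rule_span_diff [OF left [unfolded below_def] right [unfolded below_def]]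
    by (simp add: below_def)
qed

end

locale confluent_rules = quadratic_rules le M \<gamma>
  for le :: "'x list rel" and M :: "'x list set"
    and \<gamma> :: "'x list \<Rightarrow> ('x, 'k::field) free_algebra" +
  assumes overlap: "[a, b] \<in> M \<Longrightarrow> [b, c] \<in> M \<Longrightarrow>
    \<gamma> [a, b] * word [c] - word [a] * \<gamma> [b, c] \<in> below [a, b, c]"
begin

text \<open>
  Two occurrences of leading words in the same word coincide, overlap in one letter or are disjoint,
  because leading words have length 2. So only the overlaps need a hypothesis.
\<close>

lemma rules_resolve:
  assumes m: "m \<in> M" and n: "n \<in> M" and eq: "u @ m @ v = u' @ n @ v'"
  shows "word u * \<gamma> m * word v - word u' * \<gamma> n * word v' \<in> below (u @ m @ v)"
proof -
  have *: "word u * \<gamma> m * word v - word u' * \<gamma> n * word v' \<in> below (u @ m @ v)"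
    if m: "m \<in> M" and n: "n \<in> M" and eq: "u @ m @ v = u' @ n @ v'" and le: "length u \<le> length u'"
    for u m v u' n v'
  proof -
    obtain s where u': "u' = u @ s"
      using eq le by (auto simp: append_eq_append_conv2)
    then have ms: "m @ v = s @ n @ v'"
      using eq by simp
    obtain a b where ab: "m = [a, b]"
      using rule_length [OF m] by (auto simp: numeral_2_eq_2 length_Suc_conv)
    obtain c d where cd: "n = [c, d]"
      using rule_length [OF n] by (auto simp: numeral_2_eq_2 length_Suc_conv)
    consider "s = []" | "s = [a]" | t where "s = a # b # t"
      using ms ab by (cases s; cases "tl s") auto
    then show ?thesis
    proof cases
      case 1
      then show ?thesis
        using ms ab cd u' by (simp add: below_def rule_span_zero)
    next
      case 2
      then have c: "c = b" "v = d # v'"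
        using ms ab cd by auto
      have "word u * (\<gamma> m * word [d] - word [a] * \<gamma> n) * word v' \<in> below (u @ [a, b, d] @ v')"
        using below_mult [OF overlap] m n ab cd c(1) by blast
      moreover have split: "word v = word [d] * word v'" "word u' = word u * word [a]"
        using u' 2 c(2) by auto
      have "word u * \<gamma> m * word v - word u' * \<gamma> n * word v'
          = word u * (\<gamma> m * word [d] - word [a] * \<gamma> n) * word v'"
        unfolding split by (simp only: algebra_simps)
      ultimately show ?thesis
        using ab c(2) by simp
    next
      case 3
      then have v: "v = t @ n @ v'"
        using ms ab by simp
      have "word u * (\<gamma> m * word (t @ n) - word (m @ t) * \<gamma> n) * word v'
          \<in> below (u @ (m @ t @ n) @ v')"
        by (rule below_mult [OF disjoint_rules_resolve [OF m n]])
      moreover have split: "word v = word (t @ n) * word v'" "word u' = word u * word (m @ t)"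
        using u' 3 v ab by auto
      have "word u * \<gamma> m * word v - word u' * \<gamma> n * word v'
          = word u * (\<gamma> m * word (t @ n) - word (m @ t) * \<gamma> n) * word v'"
        unfolding split by (simp only: algebra_simps)
      ultimately show ?thesis
        using v by simp
    qed
  qed
  show ?thesis
  proof (cases "length u \<le> length u'")
    case True
    then show ?thesis
      using * [OF m n eq] by simp
  next
    case False
    then have "word u' * \<gamma> n * word v' - word u * \<gamma> m * word v \<in> below (u @ m @ v)"
      using * [OF n m eq [symmetric]] eq by simp
    then show ?thesis
      using rule_span_neg unfolding below_def by fastforce
  qed
qed

text \<open>
  Modulo rules applied below \<open>w\<close> all rules applied at \<open>w\<close> agree, so \<open>f\<close> is the sum of a multiple \<open>c g\<close>
  of one of them and an element of \<open>below w\<close>. If \<open>c \<noteq> 0\<close>, the leading word of \<open>f\<close> is \<open>w\<close>; if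
  \<open>c = 0\<close>, only finitely many words below \<open>w\<close> are involved, and well-founded induction applies.
\<close>

lemma leading_word_reducible:
  assumes "f \<in> rule_span M \<gamma> (\<lambda>v. (v, w) \<in> le)" "f \<noteq> 0"
  shows "\<exists>m\<in>M. \<exists>u v. leading_word le f = u @ m @ v"
  using word_order_wf [OF order] assms
proof (induction w arbitrary: f rule: wf_induct_rule)
  case (less w)
  have lower: ?case if "f \<in> below w"
  proof -
    \<comment> \<open>A combination of rules below \<open>w\<close> has a largest word, to which the induction hypothesis applies.\<close>
    let ?S = "{f. f = 0 \<or> (\<exists>w'. (w', w) \<in> le - Id \<and> f \<in> rule_span M \<gamma> (\<lambda>v. (v, w') \<in> le))}"
    have "f \<in> ?S"
      using that unfolding below_def
    proof (rule rule_span_minimal)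
      show "free_algebra.subspace ?S"
        unfolding free_algebra.subspace_def
      proof (intro conjI ballI allI)
        fix f g assume f: "f \<in> ?S" and g: "g \<in> ?S"
        show "f + g \<in> ?S"
        proof (cases "f = 0 \<or> g = 0")
          case False
          then obtain x y where x: "(x, w) \<in> le - Id" "f \<in> rule_span M \<gamma> (\<lambda>v. (v, x) \<in> le)"
            and y: "(y, w) \<in> le - Id" "g \<in> rule_span M \<gamma> (\<lambda>v. (v, y) \<in> le)"
            using f g by blast
          obtain z where z: "(z, w) \<in> le - Id" "(x, z) \<in> le" "(y, z) \<in> le"
            using x(1) y(1) word_order_total [OF order, of x y] word_order_refl [OF order] by blast
          have "f \<in> rule_span M \<gamma> (\<lambda>v. (v, z) \<in> le)" "g \<in> rule_span M \<gamma> (\<lambda>v. (v, z) \<in> le)"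
            using x(2) y(2) by (auto elim!: rule_span_mono intro: word_order_trans [OF order] z)
          then show ?thesis
            using z(1) rule_span_add by blast
        qed (use f g in auto)
      qed (auto intro: rule_span_scale)
      fix u m v assume "m \<in> M" "(u @ m @ v, w) \<in> le - Id"
      then show "word u * \<gamma> m * word v \<in> ?S"
        using rule_spanI [of m M "\<lambda>v'. (v', u @ m @ v) \<in> le" u v \<gamma>] word_order_refl [OF order]
        by blast
    qed
    then show ?thesis
      using less by blast
  qed
  show ?case
  proof (cases "\<exists>m\<in>M. \<exists>u v. w = u @ m @ v")
    case False
    have "f \<in> below w"
      using less.prems(1)
    proof (rule rule_span_minimal)
      show "free_algebra.subspace (below w)"
        by (simp add: below_def rule_span_subspace)
      fix u m v assume "m \<in> M" "(u @ m @ v, w) \<in> le"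
      with False show "word u * \<gamma> m * word v \<in> below w"
        unfolding below_def by (intro rule_spanI) auto
    qed
    then show ?thesis
      by (rule lower)
  next
    case True
    then obtain m u v where m: "m \<in> M" and w: "w = u @ m @ v"
      by blast
    let ?g = "word u * \<gamma> m * word v"
    have "f \<in> {f. \<exists>c. f - scale c ?g \<in> below w}"
      using less.prems(1)
    proof (rule rule_span_minimal)
      show "free_algebra.subspace {f. \<exists>c. f - scale c ?g \<in> below w}"
        unfolding free_algebra.subspace_def
      proof (intro conjI ballI allI)
        have "0 - scale 0 ?g \<in> below w"
          by (simp add: below_def rule_span_zero)
        then show "0 \<in> {f. \<exists>c. f - scale c ?g \<in> below w}"
          by blast
      next
        fix f g assume "f \<in> {f. \<exists>c. f - scale c ?g \<in> below w}" "g \<in> {f. \<exists>c. f - scale c ?g \<in> below w}"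
        then obtain c d where "f - scale c ?g \<in> below w" "g - scale d ?g \<in> below w"
          by blast
        then have "(f - scale c ?g) + (g - scale d ?g) \<in> below w"
          unfolding below_def by (rule rule_span_add)
        then have "f + g - scale (c + d) ?g \<in> below w"
          by (simp add: free_algebra.scale_left_distrib algebra_simps)
        then show "f + g \<in> {f. \<exists>c. f - scale c ?g \<in> below w}"
          by blast
      next
        fix c f assume "f \<in> {f. \<exists>c. f - scale c ?g \<in> below w}"
        then obtain d where "f - scale d ?g \<in> below w"
          by blast
        then have "scale c (f - scale d ?g) \<in> below w"
          unfolding below_def by (rule rule_span_scale)
        then have "scale c f - scale (c * d) ?g \<in> below w"
          by (simp add: free_algebra.scale_right_diff_distrib)
        then show "scale c f \<in> {f. \<exists>c. f - scale c ?g \<in> below w}"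
          by blast
      qed
      fix u' n v' assume n: "n \<in> M" "(u' @ n @ v', w) \<in> le"
      show "word u' * \<gamma> n * word v' \<in> {f. \<exists>c. f - scale c ?g \<in> below w}"
      proof (cases "u' @ n @ v' = w")
        case True
        then have "word u' * \<gamma> n * word v' - scale 1 ?g \<in> below w"
          using rules_resolve [OF n(1) m] w by simp
        then show ?thesis
          by blast
      next
        case False
        then have "word u' * \<gamma> n * word v' - scale 0 ?g \<in> below w"
          using n unfolding below_def by (simp add: rule_spanI)
        then show ?thesis
          by blast
      qed
    qed
    then obtain c where c: "f - scale c ?g \<in> below w"
      by blast
    show ?thesis
    proof (cases "c = 0")
      case True
      then show ?thesis
        using c lower by simp
    next
      case False
      let ?H = "{h :: ('x, 'k) free_algebra. \<forall>x\<in>support h. (x, w) \<in> le - Id}"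
      have "f - scale c ?g \<in> ?H"
        using c unfolding below_def
      proof (rule rule_span_minimal)
        show "free_algebra.subspace ?H"
          unfolding free_algebra.subspace_def
        proof (intro conjI ballI allI)
          fix f g :: "('x, 'k) free_algebra"
          assume fg: "f \<in> ?H"
            "g \<in> ?H"
          have "support (f + g) \<subseteq> support f \<union> support g"
            by (rule keys_add)
          with fg show "f + g \<in> ?H"
            by blast
        qed (auto simp: in_keys_iff)
        fix u' n v' assume n: "n \<in> M" "(u' @ n @ v', w) \<in> le - Id"
        have "(x, w) \<in> le - Id" if x: "x \<in> support (word u' * \<gamma> n * word v')" for x
        proof -
          obtain y where y: "y \<in> support (\<gamma> n)" "x = u' @ y @ v'"
            using support_word_mult [OF x] by blast
          then have "(x, u' @ n @ v') \<in> le"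
            using rule_lead [OF n(1) y(1)] word_order_append_left [OF order]
              word_order_append_right [OF order] by simp
          then show ?thesis
            using n(2) word_order_trans [OF order] word_order_antisym [OF order] by blast
        qed
        then show "word u' * \<gamma> n * word v' \<in> ?H"
          by blast
      qed
      then have tail: "(x, w) \<in> le - Id" if "x \<in> support (f - scale c ?g)" for x
        using that by blast
      have g_lead: "coeff ?g w = 1"
        using m by (simp add: w coeff_word_mult rule_monic)
      have "leading_word le f = w"
      proof (rule leading_word_eqI [OF order])
        have "coeff (f - scale c ?g) w = 0"
          using tail by (auto simp: in_keys_iff)
        then show "w \<in> support f"
          using g_lead False by (simp add: in_keys_iff lookup_minus)
        fix x assume x: "x \<in> support f"
        show "(x, w) \<in> le"
        proof (cases "x \<in> support ?g")
          case True
          then obtain y where y: "y \<in> support (\<gamma> m)" "x = u @ y @ v"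
            using support_word_mult by blast
          then show ?thesis
            using rule_lead [OF m y(1)] word_order_append_left [OF order]
              word_order_append_right [OF order] by (simp add: w)
        next
          case False
          then have "x \<in> support (f - scale c ?g)"
            using x by (simp add: in_keys_iff lookup_minus)
          then show ?thesis
            using tail by blast
        qed
      qed
      then show ?thesis
        using m w by blast
    qed
  qed
qed

lemma rules_groebner:
  assumes "R \<subseteq> free_algebra.span (\<gamma> ` M)"
  shows "word_groebner le (\<gamma> ` M) (two_sided_ideal hull R)"
  unfolding word_groebner_def
proof
  fix f assume f: "f \<in> two_sided_ideal hull R - {0}"
  let ?I = "{f. \<exists>w. f \<in> rule_span M \<gamma> (\<lambda>v. (v, w) \<in> le)}"
  have sub: "free_algebra.subspace ?I"
    unfolding free_algebra.subspace_def
  proof (intro conjI ballI allI)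
    fix f g assume "f \<in> ?I" "g \<in> ?I"
    then obtain x y where x: "f \<in> rule_span M \<gamma> (\<lambda>v. (v, x) \<in> le)"
      and y: "g \<in> rule_span M \<gamma> (\<lambda>v. (v, y) \<in> le)"
      by blast
    obtain z where z: "(x, z) \<in> le" "(y, z) \<in> le"
      using word_order_total [OF order, of x y] word_order_refl [OF order] by blast
    have "f \<in> rule_span M \<gamma> (\<lambda>v. (v, z) \<in> le)" "g \<in> rule_span M \<gamma> (\<lambda>v. (v, z) \<in> le)"
      using x y by (auto elim!: rule_span_mono intro: word_order_trans [OF order] z)
    then show "f + g \<in> ?I"
      using rule_span_add by blast
  qed (auto intro: rule_span_scale rule_span_zero)
  have mult: "word s * f * word t \<in> ?I" if f: "f \<in> ?I" for s t f
  proof -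
    obtain w where "f \<in> rule_span M \<gamma> (\<lambda>v. (v, w) \<in> le)"
      using f by blast
    then have "word s * f * word t \<in> rule_span M \<gamma> (\<lambda>v. (v, s @ w @ t) \<in> le)"
      by (rule rule_span_mult)
        (simp add: word_order_append_left [OF order] word_order_append_right [OF order])
    then show ?thesis
      by blast
  qed
  have "a * f \<in> ?I \<and> f * a \<in> ?I" if "f \<in> ?I" for a f
  proof (induction a rule: words_induct)
    case (word w)
    then show ?case
      using mult [OF that, of w "[]"] mult [OF that, of "[]" w] by simp
  next
    case (add g h)
    then show ?case
      using free_algebra.subspace_add [OF sub] by (simp only: distrib_left distrib_right)
  next
    case (scale c g)
    then show ?case
      using free_algebra.subspace_scale [OF sub] by (simp only: scale_mult_left scale_mult_right)
  qed
  then have "two_sided_ideal ?I"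
    using free_algebra.subspace_0 [OF sub] free_algebra.subspace_add [OF sub]
    unfolding two_sided_ideal_def by blast
  moreover have "R \<subseteq> ?I"
  proof -
    have "\<gamma> m \<in> ?I" if "m \<in> M" for m
      using rule_spanI [of m M "\<lambda>v. (v, m) \<in> le" "[]" "[]" \<gamma>] that word_order_refl [OF order]
      by auto
    then show ?thesis
      using assms free_algebra.span_minimal [OF _ sub, of "\<gamma> ` M"] by blast
  qed
  ultimately have "f \<in> ?I"
    using f hull_minimal [of R ?I two_sided_ideal] by blast
  then obtain m u v where m: "m \<in> M" "leading_word le f = u @ m @ v"
    using leading_word_reducible f by blast
  then have "leading_word le f = u @ leading_word le (\<gamma> m) @ v" "\<gamma> m \<in> \<gamma> ` M - {0}"
    using rule_nonzero leading_word_rule by auto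
  then show "\<exists>g\<in>\<gamma> ` M - {0}. \<exists>u v. leading_word le f = u @ leading_word le g @ v"
    by blast
qed

text \<open>
  The leading words of the rules are distinct, so the largest one that occurs in a linear combination of
  rules cannot cancel.
\<close>

lemma independent_rules:
  assumes "finite M"
  shows "free_algebra.independent (\<gamma> ` M)"
proof (rule free_algebra.independent_if_scalars_zero)
  have inj: "inj_on \<gamma> M"
    using leading_word_rule by (blast intro: inj_on_inverseI)
  fix c f
  assume sum: "(\<Sum>f\<in>\<gamma> ` M. scale (c f) f) = 0" and f: "f \<in> \<gamma> ` M"
  show "c f = 0"
  proof (rule ccontr)
    let ?N = "{m \<in> M. c (\<gamma> m) \<noteq> 0}"
    assume "c f \<noteq> 0"
    then have "?N \<noteq> {}"
      using f by blast
    then obtain m where m: "m \<in> ?N" "\<And>n. n \<in> ?N \<Longrightarrow> (n, m) \<in> le"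
      using word_order_finite_max [OF order, of ?N] assms by auto
    have "0 = coeff (\<Sum>n\<in>M. scale (c (\<gamma> n)) (\<gamma> n)) m"
      using sum inj by (simp add: sum.reindex)
    also have "\<dots> = (\<Sum>n\<in>M. if n = m then c (\<gamma> n) else 0)"
      unfolding lookup_sum
    proof (rule sum.cong)
      fix n assume n: "n \<in> M"
      show "coeff (scale (c (\<gamma> n)) (\<gamma> n)) m = (if n = m then c (\<gamma> n) else 0)"
      proof (cases "n = m \<or> c (\<gamma> n) = 0")
        case False
        then have "coeff (\<gamma> n) m = 0"
          using n m(2) [of n] rule_lead [OF n, of m] word_order_antisym [OF order]
          by (auto simp: in_keys_iff)
        then show ?thesis
          using False by simp
      qed (use n in \<open>auto simp: rule_monic\<close>)
    qed simp
    also have "\<dots> = c (\<gamma> m)"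
      using m assms by simp
    finally show False
      using m by simp
  qed
qed (simp add: assms)

end

lemma PBW_of_rules:
  fixes \<gamma> :: "'x::finite list \<Rightarrow> ('x, 'k::field) free_algebra"
  assumes "confluent_rules le M \<gamma>" "finite M"
    and "letter_change \<phi> \<psi>" "\<psi> ` R = free_algebra.span (\<gamma> ` M)"
  shows "PBW R"
proof -
  interpret confluent_rules le M \<gamma>
    by fact
  show ?thesis
    unfolding PBW_iff linear_basis_def
    using assms(2-4) order independent_rules rules_groebner [of "\<psi> ` R"]
    by (intro exI [of _ \<phi>] exI [of _ \<psi>] exI [of _ le] exI [of _ "\<gamma> ` M"]) auto
qed


section \<open>Sklyanin algebras that are PBW\<close>

definition sklyanin_form :: "'k::field \<Rightarrow> 'k \<Rightarrow> 'k \<Rightarrow>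
    ('x, 'k) free_algebra \<Rightarrow> ('x, 'k) free_algebra \<Rightarrow> ('x, 'k) free_algebra \<Rightarrow> ('x, 'k) free_algebra" where
  "sklyanin_form p q r a b c = scale p (b * c) + scale q (c * b) + scale r (a * a)"

lemma sklyanin_relations_form:
  "sklyanin_relations p q r = free_algebra.span
     {sklyanin_form p q r (letter X) (letter Y) (letter Z),
      sklyanin_form p q r (letter Y) (letter Z) (letter X),
      sklyanin_form p q r (letter Z) (letter X) (letter Y)}"
  by (simp add: sklyanin_relations_def sklyanin_form_def Let_def)

lemma algebra_hom_sklyanin_form:
  "algebra_hom h \<Longrightarrow> h (sklyanin_form p q r a b c) = sklyanin_form p q r (h a) (h b) (h c)"
  by (simp add: sklyanin_form_def algebra_hom_simps)

lemmas coeff_simps = letter_eq_word distrib_left distrib_right left_diff_distrib right_diff_distrib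
  scale_mult_left scale_mult_right free_algebra.scale_right_distrib
  free_algebra.scale_right_diff_distrib lookup_add lookup_minus lookup_word

lemma UNIV_xyz: "(UNIV :: xyz set) = {X, Y, Z}"
  using xyz.exhaust by auto

lemma sum_xyz: "(\<Sum>a\<in>UNIV. f a) = f X + f Y + f Z" for f :: "xyz \<Rightarrow> 'a::comm_monoid_add"
  by (simp add: UNIV_xyz add.assoc)

definition deglex :: "xyz list rel" where
  "deglex = (lenlex {(Z, Y), (Z, X), (Y, X)})\<^sup>="

lemma word_order_deglex: "word_order deglex"
proof -
  let ?r = "{(Z, Y), (Z, X), (Y, X)}"
  have r: "trans ?r" "irrefl ?r" "asym ?r"
    by (auto simp: trans_def irrefl_def intro!: asymI)
  have wf: "wf ?r"
  proof (rule wf_subset [OF wf_measure])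
    show "?r \<subseteq> measure (\<lambda>a. case a of X \<Rightarrow> 2 | Y \<Rightarrow> 1 | Z \<Rightarrow> 0)"
      by auto
  qed
  have "total ?r"
    unfolding total_on_def
  proof (intro ballI impI)
    fix a b :: xyz assume "a \<noteq> b"
    then show "(a, b) \<in> ?r \<or> (b, a) \<in> ?r"
      by (cases a; cases b) auto
  qed
  then have total: "total (lenlex ?r)"
    by (rule total_lenlex)
  have trans: "trans (lenlex ?r)"
    using r(1) by (rule lenlex_transI)
  have asym: "asym (lenlex ?r)"
    using r(3) by (rule asym_lenlex)
  have "well_order_on UNIV deglex"
    unfolding well_order_on_def linear_order_on_def partial_order_on_def preorder_on_def
  proof (intro conjI)
    show "refl deglex" "deglex \<subseteq> UNIV \<times> UNIV"
      by (auto simp: deglex_def refl_on_def)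
    show "trans deglex"
      using transD [OF trans] by (auto simp: deglex_def intro!: transI)
    show "antisym deglex"
      unfolding deglex_def antisym_def using asymD [OF asym] by blast
    show "total deglex"
      unfolding deglex_def using total by (auto simp: total_on_def)
    show "wf (deglex - Id)"
      by (rule wf_subset [OF wf_lenlex [OF wf]]) (auto simp: deglex_def)
  qed
  moreover have "(w @ u, w @ v) \<in> deglex \<and> (u @ w, v @ w) \<in> deglex" if "(u, v) \<in> deglex" for u v w
    using that r(2) lenlex_append1 [of u v ?r w w] by (auto simp: deglex_def)
  ultimately show ?thesis
    by (auto simp: word_order_def)
qed

lemma deglex_length2:
  assumes "length u = 2" "length v = 2"
  shows "(u, v) \<in> deglex \<longleftrightarrow> u = v \<or>
    (hd u, hd v) \<in> {(Z, Y), (Z, X), (Y, X)} \<or>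
    hd u = hd v \<and> (last u, last v) \<in> {(Z, Y), (Z, X), (Y, X)}"
proof -
  obtain a b c d where "u = [a, b]" "v = [c, d]"
    using assms by (auto simp: numeral_2_eq_2 length_Suc_conv)
  then show ?thesis
    by (auto simp: deglex_def Cons_lenlex_iff)
qed

lemma span_scale_three:
  assumes "a \<noteq> 0" "b \<noteq> 0" "c \<noteq> 0"
  shows "free_algebra.span {scale a f, scale b g, scale c h} = free_algebra.span {f, g, h}"
  unfolding free_algebra.span_eq
proof (intro conjI insert_subsetI empty_subsetI)
  show "f \<in> free_algebra.span {scale a f, scale b g, scale c h}"
    using free_algebra.span_scale [OF free_algebra.span_base, of "scale a f" _ "1 / a"] assms by simp
  show "g \<in> free_algebra.span {scale a f, scale b g, scale c h}"
    using free_algebra.span_scale [OF free_algebra.span_base, of "scale b g" _ "1 / b"] assms by simp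
  show "h \<in> free_algebra.span {scale a f, scale b g, scale c h}"
    using free_algebra.span_scale [OF free_algebra.span_base, of "scale c h" _ "1 / c"] assms by simp
qed (auto intro: free_algebra.span_scale free_algebra.span_base)

lemma letter_change_id: "letter_change id id"
  by (simp add: letter_change_def algebra_hom_def)

text \<open>
  Rewriting a word by a monomial rule gives 0, so overlaps resolve trivially.
\<close>

lemma PBW_monomial:
  fixes M :: "'x::finite list set"
  assumes "word_order (le :: 'x list rel)" "finite M" "\<And>m. m \<in> M \<Longrightarrow> length m = 2"
  shows "PBW (free_algebra.span (word ` M) :: ('x, 'k::field) free_algebra set)"
proof (rule PBW_of_rules [OF _ assms(2) letter_change_id])
  show "confluent_rules le M (word :: 'x list \<Rightarrow> ('x, 'k) free_algebra)"
  proof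
    interpret quadratic_rules le M "word :: 'x list \<Rightarrow> ('x, 'k) free_algebra"
      using assms(1,3) word_order_refl [OF assms(1)]
      by unfold_locales (auto simp: lookup_word in_keys_iff split: if_splits)
    show "word [a, b] * word [c] - word [a] * word [b, c] \<in> below [a, b, c]" for a b c
      by (simp add: below_def rule_span_zero)
  qed (use assms(1,3) word_order_refl [OF assms(1)] in
      \<open>auto simp: lookup_word in_keys_iff split: if_splits\<close>)
qed simp

text \<open>
  The conditions on the coefficients say that the leading words are \<open>xy\<close>, \<open>xz\<close>, \<open>yz\<close>, so \<open>xyz\<close> is the
  only overlap. Solved for \<open>k g1 z - x g3\<close>, the syzygy expresses the two ways of rewriting \<open>xyz\<close> by rules
  applied at \<open>zxy\<close>, \<open>yzx\<close>, \<open>yxz\<close> and \<open>xzy\<close>, which are all smaller.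
\<close>

lemma PBW_ordered:
  fixes g1 g2 g3 :: "(xyz, 'k::field) free_algebra"
  assumes change: "letter_change \<phi> \<psi>" and span: "\<psi> ` R = free_algebra.span {g1, g2, g3}"
    and length: "\<And>g w. g \<in> {g1, g2, g3} \<Longrightarrow> w \<in> support g \<Longrightarrow> length w = 2"
    and g1: "coeff g1 [X, X] = 0" "coeff g1 [X, Y] \<noteq> 0"
    and g2: "coeff g2 [X, X] = 0" "coeff g2 [X, Y] = 0" "coeff g2 [X, Z] \<noteq> 0"
    and g3: "coeff g3 [X, X] = 0" "coeff g3 [X, Y] = 0" "coeff g3 [X, Z] = 0"
      "coeff g3 [Y, X] = 0" "coeff g3 [Y, Y] = 0" "coeff g3 [Y, Z] \<noteq> 0"
    and k: "coeff g3 [Y, Z] = k * coeff g1 [X, Y]"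
    and syzygy: "letter X * g3 - g3 * letter X + letter Y * g2 - g2 * letter Y
      + scale k (letter Z * g1 - g1 * letter Z) = 0"
  shows "PBW R"
proof -
  define M where "M = {[X, Y], [X, Z], [Y, Z]}"
  define G where "G m = (if m = [X, Y] then g1 else if m = [X, Z] then g2 else g3)" for m
  define \<gamma> where "\<gamma> m = scale (1 / coeff (G m) m) (G m)" for m
  have M_nz: "coeff (G m) m \<noteq> 0" if "m \<in> M" for m
    using that g1 g2 g3 by (auto simp: M_def G_def)
  have G_lead: "(w, m) \<in> deglex" if m: "m \<in> M" and w: "w \<in> support (G m)" for m w
  proof -
    have lw: "length w = 2"
      using length w by (auto simp: G_def split: if_splits)
    then obtain a b where ab: "w = [a, b]"
      by (auto simp: numeral_2_eq_2 length_Suc_conv)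
    have "coeff (G m) w \<noteq> 0"
      using w by (simp add: in_keys_iff)
    then show ?thesis
      using m g1 g2 g3 unfolding ab M_def G_def
      by (cases a; cases b) (auto simp: deglex_length2 split: if_splits)
  qed
  have "quadratic_rules deglex M \<gamma>"
  proof
    show "word_order deglex"
      by (rule word_order_deglex)
    show "length m = 2" if "m \<in> M" for m
      using that by (auto simp: M_def)
    show "coeff (\<gamma> m) m = 1" if "m \<in> M" for m
      using M_nz [OF that] by (simp add: \<gamma>_def)
    show "(w, m) \<in> deglex" if "m \<in> M" "w \<in> support (\<gamma> m)" for m w
      using G_lead that by (simp add: \<gamma>_def in_keys_iff)
  qed
  then interpret quadratic_rules deglex M \<gamma> .
  have "confluent_rules deglex M \<gamma>"
  proof
    fix a b c assume ab: "[a, b] \<in> M" and bc: "[b, c] \<in> M"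
    have "k \<noteq> 0"
      using g3 k by auto
    let ?c1 = "coeff g1 [X, Y]" and ?c2 = "coeff g2 [X, Z]" and ?c3 = "coeff g3 [Y, Z]"
    have abc: "a = X" "b = Y" "c = Z"
      using ab bc by (auto simp: M_def)
    have \<gamma>: "\<gamma> [X, Y] = scale (1 / ?c1) g1" "\<gamma> [X, Z] = scale (1 / ?c2) g2" "\<gamma> [Y, Z] = scale (1 / ?c3) g3"
      by (auto simp: \<gamma>_def G_def)
    let ?lower = "scale k (word [Z] * \<gamma> [X, Y] * word []) - scale (?c3 / ?c1) (word [] * \<gamma> [Y, Z] * word [X])
        + scale (?c2 / ?c1) (word [Y] * \<gamma> [X, Z] * word []) - scale (?c2 / ?c1) (word [] * \<gamma> [X, Z] * word [Y])"
    have "?lower \<in> below [X, Y, Z]"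
      unfolding below_def
      by (intro rule_span_add rule_span_diff rule_span_scale rule_spanI)
        (auto simp: M_def deglex_def Cons_lenlex_iff)
    moreover have "scale k (\<gamma> [X, Y] * word [Z] - word [X] * \<gamma> [Y, Z]) = ?lower"
    proof -
      have "scale k (g1 * letter Z) = letter X * g3 - g3 * letter X + letter Y * g2 - g2 * letter Y
          + scale k (letter Z * g1)"
        using syzygy by (simp add: free_algebra.scale_right_diff_distrib algebra_simps)
      then have "scale (1 / ?c1) (scale k (g1 * letter Z))
          = scale (1 / ?c1) (letter X * g3 - g3 * letter X + letter Y * g2 - g2 * letter Y
          + scale k (letter Z * g1))"
        by simp
      then show ?thesis
        using g1 g2 g3 k
        by (simp add: \<gamma> letter_eq_word scale_mult_left scale_mult_right
            free_algebra.scale_right_diff_distrib free_algebra.scale_right_distrib algebra_simps)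
    qed
    ultimately have "scale k (\<gamma> [X, Y] * word [Z] - word [X] * \<gamma> [Y, Z]) \<in> below [X, Y, Z]"
      by simp
    from rule_span_scale [OF this [unfolded below_def], of "1 / k"]
    have "scale (1 / k) (scale k (\<gamma> [X, Y] * word [Z] - word [X] * \<gamma> [Y, Z])) \<in> below [X, Y, Z]"
      by (simp add: below_def)
    then show "\<gamma> [a, b] * word [c] - word [a] * \<gamma> [b, c] \<in> below [a, b, c]"
      using \<open>k \<noteq> 0\<close> by (simp add: abc)
  qed
  moreover have "\<psi> ` R = free_algebra.span (\<gamma> ` M)"
  proof -
    have "\<gamma> ` M = {scale (1 / coeff g1 [X, Y]) g1, scale (1 / coeff g2 [X, Z]) g2,
        scale (1 / coeff g3 [Y, Z]) g3}"
      by (simp add: \<gamma>_def G_def M_def)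
    then show ?thesis
      using g1 g2 g3 by (simp add: span span_scale_three)
  qed
  moreover have "finite M"
    by (simp add: M_def)
  ultimately show ?thesis
    by (intro PBW_of_rules [OF _ _ change])
qed

text \<open>
  All coefficients are nonzero, so the relations can be solved for \<open>xx\<close>, \<open>xy\<close> and \<open>xz\<close>.
\<close>

lemma PBW_cubes:
  fixes p q r :: "'k::field"
  assumes "p \<noteq> 0" "q \<noteq> 0" "r \<noteq> 0" and cubes: "p ^ 3 = q ^ 3" "q ^ 3 = r ^ 3"
  shows "PBW (sklyanin_relations p q r)"
proof -
  define M where "M = {[X, X], [X, Y], [X, Z]}"
  define G where "G m =
    (if m = [X, X] then sklyanin_form p q r (letter X) (letter Y) (letter Z)
     else if m = [X, Z] then sklyanin_form p q r (letter Y) (letter Z) (letter X)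
     else sklyanin_form p q r (letter Z) (letter X) (letter Y))" for m
  define lc where "lc m = (if m = [X, X] then r else if m = [X, Z] then q else p)" for m
  define \<gamma> where "\<gamma> m = scale (1 / lc m) (G m)" for m
  have \<gamma>: "\<gamma> [X, X] = word [X, X] + scale (p / r) (word [Y, Z]) + scale (q / r) (word [Z, Y])"
    "\<gamma> [X, Z] = word [X, Z] + scale (p / q) (word [Z, X]) + scale (r / q) (word [Y, Y])"
    "\<gamma> [X, Y] = word [X, Y] + scale (q / p) (word [Y, X]) + scale (r / p) (word [Z, Z])"
    using assms by (simp_all add: \<gamma>_def G_def lc_def sklyanin_form_def letter_eq_word
        free_algebra.scale_right_distrib)
  have "quadratic_rules deglex M \<gamma>"
  proof
    show "word_order deglex"
      by (rule word_order_deglex)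
    show "length m = 2" if "m \<in> M" for m
      using that by (auto simp: M_def)
    show "coeff (\<gamma> m) m = 1" if "m \<in> M" for m
      using that by (auto simp: M_def \<gamma> lookup_add lookup_word)
    show "(w, m) \<in> deglex" if "m \<in> M" "w \<in> support (\<gamma> m)" for m w
      using that by (auto simp: M_def \<gamma> lookup_add lookup_word in_keys_iff deglex_length2 split: if_splits)
  qed
  then interpret quadratic_rules deglex M \<gamma> .
  have "confluent_rules deglex M \<gamma>"
  proof
    fix a b c assume ab: "[a, b] \<in> M" and bc: "[b, c] \<in> M"
    have a: "a = X" "b = X"
      using ab bc by (auto simp: M_def)
    have lower: "\<gamma> m * word [d] \<in> below [X, X, c]" "word [e] * \<gamma> m \<in> below [X, X, c]"
      if "m \<in> M" "m \<noteq> [X, X]" "e \<noteq> X" for m d e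
    proof -
      have "word [] * \<gamma> m * word [d] \<in> below [X, X, c]" "word [e] * \<gamma> m * word [] \<in> below [X, X, c]"
        unfolding below_def
        by (intro rule_spanI that; use that in \<open>cases e; auto simp: M_def deglex_def Cons_lenlex_iff\<close>)+
      then show "\<gamma> m * word [d] \<in> below [X, X, c]" "word [e] * \<gamma> m \<in> below [X, X, c]"
        by simp_all
    qed
    have lower_XX: "word [e] * \<gamma> [X, X] \<in> below [X, X, c]" if "e \<noteq> X" for e
    proof -
      have "word [e] * \<gamma> [X, X] * word [] \<in> below [X, X, c]"
        unfolding below_def
        by (intro rule_spanI; use that in \<open>cases e; auto simp: M_def deglex_def Cons_lenlex_iff\<close>)
      then show ?thesis
        by simp
    qed
    note combine = rule_span_add rule_span_diff rule_span_scale
    show "\<gamma> [a, b] * word [c] - word [a] * \<gamma> [b, c] \<in> below [a, b, c]"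
    proof (cases c)
      case X
      \<comment> \<open>The syzygy of the Sklyanin relations, divided by \<open>r\<close>; it holds for all parameters.\<close>
      have "\<gamma> [X, X] * word [X] - word [X] * \<gamma> [X, X]
          = scale (q / r) (word [Y] * \<gamma> [X, Z]) + scale (p / r) (word [Z] * \<gamma> [X, Y])
            - scale (p / r) (\<gamma> [X, Y] * word [Z]) - scale (q / r) (\<gamma> [X, Z] * word [Y])"
        by (rule poly_mapping_eqI) (use assms in \<open>auto simp: \<gamma> coeff_simps divide_simps\<close>)
      also have "\<dots> \<in> below [X, X, c]"
        unfolding below_def
        by (intro combine lower [unfolded below_def]) (auto simp: M_def)
      finally show ?thesis
        by (simp add: a X)
    next
      case Y
      \<comment> \<open>The words \<open>yyz\<close>, \<open>yzy\<close>, \<open>zzx\<close> and \<open>zyy\<close> cancel because the cubes are equal.\<close>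
      have "\<gamma> [X, X] * word [Y] - word [X] * \<gamma> [X, Y]
          = scale (q\<^sup>2 / p\<^sup>2) (word [Y] * \<gamma> [X, X]) + scale (r / q) (word [Z] * \<gamma> [X, Z])
            - scale (q / p) (\<gamma> [X, Y] * word [X]) - scale (r / p) (\<gamma> [X, Z] * word [Z])"
        by (rule poly_mapping_eqI)
          (use assms in \<open>auto simp: \<gamma> coeff_simps field_simps power2_eq_square power3_eq_cube\<close>)
      also have "\<dots> \<in> below [X, X, c]"
        unfolding below_def
        by (intro combine lower [unfolded below_def] lower_XX [unfolded below_def]) (auto simp: M_def)
      finally show ?thesis
        by (simp add: a Y)
    next
      case Z
      \<comment> \<open>The previous identity with \<open>p\<close>, \<open>q\<close> and \<open>y\<close>, \<open>z\<close> exchanged.\<close>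
      have "\<gamma> [X, X] * word [Z] - word [X] * \<gamma> [X, Z]
          = scale (p\<^sup>2 / q\<^sup>2) (word [Z] * \<gamma> [X, X]) + scale (r / p) (word [Y] * \<gamma> [X, Y])
            - scale (p / q) (\<gamma> [X, Z] * word [X]) - scale (r / q) (\<gamma> [X, Y] * word [Y])"
        by (rule poly_mapping_eqI)
          (use assms in \<open>auto simp: \<gamma> coeff_simps field_simps power2_eq_square power3_eq_cube\<close>)
      also have "\<dots> \<in> below [X, X, c]"
        unfolding below_def
        by (intro combine lower [unfolded below_def] lower_XX [unfolded below_def]) (auto simp: M_def)
      finally show ?thesis
        by (simp add: a Z)
    qed
  qed
  moreover have "id ` sklyanin_relations p q r = free_algebra.span (\<gamma> ` M)"
    using assms by (simp add: M_def \<gamma>_def G_def lc_def span_scale_three sklyanin_relations_form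
        insert_commute)
  moreover have "finite M"
    by (simp add: M_def)
  ultimately show ?thesis
    by (intro PBW_of_rules [OF _ _ letter_change_id])
qed

lemma sum_letters_degree_one:
  "scale a (letter X) + scale b (letter Y) + scale c (letter Z) \<in> degree_one"
  unfolding degree_one_def
  by (intro free_algebra.span_add free_algebra.span_scale free_algebra.span_base) auto

lemma sklyanin_syzygy:
  "a * sklyanin_form p q r a b c - sklyanin_form p q r a b c * a +
   (b * sklyanin_form p q r b c a - sklyanin_form p q r b c a * b) +
   (c * sklyanin_form p q r c a b - sklyanin_form p q r c a b * c) = 0"
  by (simp add: sklyanin_form_def scale_mult_left scale_mult_right algebra_simps)

lemma sklyanin_form_degree_two:
  assumes "a \<in> degree_one" "b \<in> degree_one" "c \<in> degree_one"
  shows "sklyanin_form p q r a b c \<in> degree_two"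
  unfolding sklyanin_form_def degree_two_def
  by (intro free_algebra.span_add free_algebra.span_scale free_algebra.span_base)
    (use assms in auto)

text \<open>
  The relations are those of a quantum affine space, with leading words \<open>xy\<close>, \<open>xz\<close>, \<open>yz\<close>.
\<close>

lemma PBW_quantum:
  fixes p q :: "'k::field"
  assumes "p \<noteq> 0" "q \<noteq> 0"
  shows "PBW (sklyanin_relations p q 0)"
proof (rule PBW_ordered [OF letter_change_id])
  let ?g1 = "sklyanin_form p q 0 (letter Z) (letter X) (letter Y)"
  let ?g2 = "sklyanin_form p q 0 (letter Y) (letter Z) (letter X)"
  let ?g3 = "sklyanin_form p q 0 (letter X) (letter Y) (letter Z)"
  show "id ` sklyanin_relations p q 0 = free_algebra.span {?g1, ?g2, ?g3}"
    by (simp add: sklyanin_relations_form insert_commute)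
  show "length w = 2" if "g \<in> {?g1, ?g2, ?g3}" "w \<in> support g" for g w
    using that by (auto simp: sklyanin_form_def coeff_simps in_keys_iff split: if_splits)
  show "letter X * ?g3 - ?g3 * letter X + letter Y * ?g2 - ?g2 * letter Y
      + scale 1 (letter Z * ?g1 - ?g1 * letter Z) = 0"
    by (simp add: sklyanin_form_def scale_mult_left scale_mult_right algebra_simps)
qed (use assms in \<open>simp_all add: sklyanin_form_def coeff_simps\<close>)

text \<open>
  Rescaling \<open>x\<close> by \<open>t\<^sup>2\<close>, where \<open>t = - (p + q) / r\<close> is a cube root of unity, turns \<open>r\<close> into
  \<open>s = - (p + q)\<close>. Then the relations have no \<open>xx\<close>-term once \<open>y\<close> is replaced by \<open>x + y\<close> and \<open>z\<close> by
  \<open>x - w\<^sup>2 y + w z\<close>, where \<open>- w\<^sup>2 = 1 + w\<close>: the coefficients of \<open>x\<close> in the new expressions are the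
  coordinates of the point \<open>(1, 1, 1)\<close> at which the relations vanish. The combinations \<open>g1\<close>, \<open>g2\<close>, \<open>g3\<close> of
  the relations have the leading words \<open>xy\<close>, \<open>xz\<close>, \<open>yz\<close>, and up to nonzero factors their leading
  coefficients are \<open>p - w q\<close>, \<open>p - w\<^sup>2 q\<close> and \<open>p - w q\<close>.
\<close>

lemma PBW_sum_cube:
  fixes p q r w :: "'k::field"
  assumes sum: "(p + q) ^ 3 + r ^ 3 = 0" and w: "w ^ 2 + w + 1 = 0"
    and r: "r \<noteq> 0" and not_cubes: "\<not> (p ^ 3 = q ^ 3 \<and> q ^ 3 = r ^ 3)"
  shows "PBW (sklyanin_relations p q r)"
proof -
  define s where "s = - (p + q)"
  define t where "t = s / r"
  have w2: "w * w = - 1 - w"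
    using w by (simp add: power2_eq_square) algebra
  have s3: "s ^ 3 = r ^ 3"
    using sum unfolding s_def by algebra
  then have t3: "t ^ 3 = 1"
    using r by (simp add: t_def power_divide)
  have s: "s = r * t"
    using r by (simp add: t_def)
  have pw: "p \<noteq> w * q"
  proof
    assume "p = w * q"
    then have "p ^ 3 = q ^ 3" "s ^ 3 = q ^ 3"
      using w unfolding s_def by algebra+
    then show False
      using not_cubes s3 by simp
  qed
  have pw2: "p \<noteq> w\<^sup>2 * q"
  proof
    assume "p = w\<^sup>2 * q"
    then have "p ^ 3 = q ^ 3" "s ^ 3 = q ^ 3"
      using w unfolding s_def by algebra+
    then show False
      using not_cubes s3 by simp
  qed
  define y :: "(xyz, 'k) free_algebra" where "y = letter X + letter Y"
  define z :: "(xyz, 'k) free_algebra" where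
    "z = letter X + scale (1 + w) (letter Y) + scale w (letter Z)"
  define b :: "xyz \<Rightarrow> (xyz, 'k) free_algebra" where "b a = (case a of
      X \<Rightarrow> scale t (letter X)
    | Y \<Rightarrow> letter Y - scale t (letter X)
    | Z \<Rightarrow> scale t (letter X) + scale w (letter Y) + scale (w\<^sup>2) (letter Z))" for a
  define c :: "xyz \<Rightarrow> (xyz, 'k) free_algebra" where "c a = (case a of
      X \<Rightarrow> scale (t\<^sup>2) (letter X) | Y \<Rightarrow> y | Z \<Rightarrow> z)" for a
  have change: "letter_change (subst b) (subst c)"
  proof (rule letter_changeI)
    note hom_simps = algebra_hom_simps [OF algebra_hom_subst] algebra_hom_diff [OF algebra_hom_subst]
    have t: "t * (t * t) = 1"
      using t3 by (simp add: power3_eq_cube mult.assoc)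
    show "subst b (c a) = letter a" for a
      by (cases a; simp add: c_def b_def y_def z_def hom_simps; rule poly_mapping_eqI;
          auto simp: coeff_simps power2_eq_square t w2 algebra_simps)
    show "subst c (b a) = letter a" for a
      by (cases a; simp add: c_def b_def y_def z_def hom_simps; rule poly_mapping_eqI;
          auto simp: coeff_simps power2_eq_square t w2 algebra_simps)
    show "b a \<in> degree_one" for a
      using sum_letters_degree_one [of t 0 0] sum_letters_degree_one [of "- t" 1 0]
        sum_letters_degree_one [of t w "w\<^sup>2"]
      by (cases a) (simp_all add: b_def)
    show "c a \<in> degree_one" for a
      using sum_letters_degree_one [of "t\<^sup>2" 0 0] sum_letters_degree_one [of 1 1 0]
        sum_letters_degree_one [of 1 "1 + w" w]
      by (cases a) (simp_all add: c_def y_def z_def)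
  qed
  define f1 where "f1 = sklyanin_form p q s (letter X) y z"
  define f2 where "f2 = sklyanin_form p q s y z (letter X)"
  define g1 where "g1 = sklyanin_form p q s z (letter X) y"
  define g2 where "g2 = f2 + scale (1 + w) g1"
  define g3 where "g3 = f1 + f2 + g1"
  note defs = g1_def g2_def g3_def f1_def f2_def y_def z_def sklyanin_form_def coeff_simps
  have y: "y \<in> degree_one" and z: "z \<in> degree_one"
    using sum_letters_degree_one [of 1 1 0] sum_letters_degree_one [of 1 "1 + w" w]
    by (simp_all add: y_def z_def)
  show ?thesis
  proof (rule PBW_ordered [OF change])
    show "subst c ` sklyanin_relations p q r = free_algebra.span {g1, g2, g3}"
    proof -
      have t: "t * (t * t) = 1" "t \<noteq> 0"
        using t3 by (auto simp: power3_eq_cube mult.assoc)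
      then have rt: "r = t\<^sup>2 * s" "s = r * (t\<^sup>2 * t\<^sup>2)"
        using s by (auto simp: power2_eq_square mult.assoc)
      have c: "c X = scale (t\<^sup>2) (letter X)" "c Y = y" "c Z = z"
        by (simp_all add: c_def)
      have "sklyanin_form p q r (scale (t\<^sup>2) (letter X)) y z = scale 1 f1"
        by (simp add: sklyanin_form_def f1_def scale_mult_left scale_mult_right rt(2))
      moreover have "sklyanin_form p q r y z (scale (t\<^sup>2) (letter X)) = scale (t\<^sup>2) f2"
        by (simp add: sklyanin_form_def f2_def scale_mult_left scale_mult_right rt(1) mult.commute
            free_algebra.scale_right_distrib)
      moreover have "sklyanin_form p q r z (scale (t\<^sup>2) (letter X)) y = scale (t\<^sup>2) g1"
        by (simp add: sklyanin_form_def g1_def scale_mult_left scale_mult_right rt(1) mult.commute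
            free_algebra.scale_right_distrib)
      ultimately have "subst c ` sklyanin_relations p q r
          = free_algebra.span {scale 1 f1, scale (t\<^sup>2) f2, scale (t\<^sup>2) g1}"
        unfolding sklyanin_relations_form algebra_hom_span [OF algebra_hom_subst, symmetric]
        by (simp add: algebra_hom_sklyanin_form [OF algebra_hom_subst] c del: free_algebra.scale_one)
      also have "\<dots> = free_algebra.span {f1, f2, g1}"
        using t by (intro span_scale_three) auto
      also have "\<dots> = free_algebra.span {g1, g2, g3}"
      proof -
        have f2: "f2 = g2 - scale (1 + w) g1" and f1: "f1 = g3 - (g2 - scale (1 + w) g1) - g1"
          by (simp_all add: g2_def g3_def)
        have "f1 \<in> free_algebra.span {g1, g2, g3}" "f2 \<in> free_algebra.span {g1, g2, g3}"
          unfolding f1 f2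
          by (intro free_algebra.span_diff free_algebra.span_scale free_algebra.span_base; simp)+
        moreover have "g2 \<in> free_algebra.span {f1, f2, g1}" "g3 \<in> free_algebra.span {f1, f2, g1}"
          unfolding g2_def g3_def
          by (intro free_algebra.span_add free_algebra.span_scale free_algebra.span_base; simp)+
        ultimately show ?thesis
          by (simp add: free_algebra.span_eq free_algebra.span_base)
      qed
      finally show ?thesis .
    qed
    have "f1 \<in> degree_two" "f2 \<in> degree_two" "g1 \<in> degree_two"
      unfolding f1_def f2_def g1_def by (intro sklyanin_form_degree_two y z letter_in_degree_one)+
    then show "length v = 2" if "g \<in> {g1, g2, g3}" "v \<in> support g" for g v
      using that degree_two_length [of g v] unfolding g2_def g3_def degree_two_def
      by (auto intro: free_algebra.span_add free_algebra.span_scale)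
    show "coeff g1 [X, X] = 0" "coeff g2 [X, X] = 0" "coeff g3 [X, X] = 0"
      by (simp_all add: defs s_def)
    have "w * (p - w * q) = - coeff g1 [X, Y] - q * (w\<^sup>2 + w + 1)"
      by (simp add: defs s_def algebra_simps power2_eq_square)
    then have "w * (p - w * q) = 0" if "coeff g1 [X, Y] = 0"
      using that by (simp add: w)
    moreover have "w \<noteq> 0"
      using w by auto
    ultimately have "p = w * q" if "coeff g1 [X, Y] = 0"
      using that by simp
    with pw show lead1: "coeff g1 [X, Y] \<noteq> 0"
      by blast
    have "p = w\<^sup>2 * q" if "coeff g2 [X, Z] = 0"
      using that w by (simp add: defs s_def; algebra)
    with pw2 show "coeff g2 [X, Z] \<noteq> 0"
      by blast
    show lead3: "coeff g3 [Y, Z] = w * coeff g1 [X, Y]"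
      using w by (simp add: defs s_def)
    show "coeff g3 [Y, Z] \<noteq> 0"
      using lead1 lead3 w by auto
    show "coeff g2 [X, Y] = 0"
      using w by (simp add: defs s_def; algebra)
    show "coeff g3 [X, Y] = 0"
      using w by (simp add: defs s_def; algebra)
    show "coeff g3 [Y, X] = 0"
      using w by (simp add: defs s_def; algebra)
    show "coeff g3 [X, Z] = 0"
      using w by (simp add: defs s_def; algebra)
    show "coeff g3 [Y, Y] = 0"
      using w by (simp add: defs s_def; algebra)
    show "letter X * g3 - g3 * letter X + letter Y * g2 - g2 * letter Y
        + scale w (letter Z * g1 - g1 * letter Z) = 0"
    proof -
      \<comment> \<open>In terms of \<open>x\<close>, \<open>y\<close>, \<open>z\<close> and \<open>f1\<close>, \<open>f2\<close>, \<open>g1\<close> this is the syzygy of the Sklyanin relations.\<close>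
      have wZ: "scale w (letter Z) = z - letter X - scale (1 + w) (letter Y)"
        by (simp add: z_def)
      have "scale w (letter Z * g1 - g1 * letter Z) = scale w (letter Z) * g1 - g1 * scale w (letter Z)"
        by (simp add: scale_mult_left scale_mult_right free_algebra.scale_right_diff_distrib)
      also have "letter X * g3 - g3 * letter X + letter Y * g2 - g2 * letter Y + \<dots>
          = letter X * f1 - f1 * letter X + (y * f2 - f2 * y) + (z * g1 - g1 * z)"
        unfolding wZ g2_def g3_def y_def
        by (simp add: scale_mult_left scale_mult_right algebra_simps)
      also have "\<dots> = 0"
        unfolding f1_def f2_def g1_def by (rule sklyanin_syzygy)
      finally show ?thesis .
    qed
  qed
qed

lemma PBW_sufficient:
  fixes p q r :: "'k::field"
  assumes "(p * r = 0 \<and> q * r = 0) \<or> (p ^ 3 = q ^ 3 \<and> q ^ 3 = r ^ 3) \<or>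
    ((p + q) ^ 3 + r ^ 3 = 0 \<and> (\<exists>t::'k. t ^ 2 + t + 1 = 0))"
  shows "PBW (sklyanin_relations p q r)"
proof -
  have monomial: "PBW (free_algebra.span {word [a, b], word [c, d], word [e, f]} :: (xyz, 'k) free_algebra set)"
    for a b c d e f
  proof -
    have "PBW (free_algebra.span (word ` {[a, b], [c, d], [e, f]}) :: (xyz, 'k) free_algebra set)"
      by (rule PBW_monomial [OF word_order_deglex]) auto
    then show ?thesis
      by simp
  qed
  have r0: "PBW (sklyanin_relations p q r)" if "r = 0"
  proof -
    consider "p = 0" "q = 0" | "p = 0" "q \<noteq> 0" | "p \<noteq> 0" "q = 0" | "p \<noteq> 0" "q \<noteq> 0"
      by blast
    then show ?thesis
    proof cases
      case 1
      then show ?thesis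
        using PBW_monomial [OF word_order_deglex, of "{}", where 'k = 'k] that
        by (simp add: sklyanin_relations_form sklyanin_form_def free_algebra.span_insert_0)
    next
      case 2
      then show ?thesis
        using monomial that
        by (simp add: sklyanin_relations_form sklyanin_form_def span_scale_three letter_eq_word)
    next
      case 3
      then show ?thesis
        using monomial that
        by (simp add: sklyanin_relations_form sklyanin_form_def span_scale_three letter_eq_word)
    next
      case 4
      then show ?thesis
        using PBW_quantum that by simp
    qed
  qed
  have cubes: "PBW (sklyanin_relations p q r)" if "p ^ 3 = q ^ 3" "q ^ 3 = r ^ 3" "r \<noteq> 0"
  proof -
    have "q \<noteq> 0" "p \<noteq> 0"
      using that by auto
    then show ?thesis
      using PBW_cubes that by blast
  qed
  show ?thesis
  proof (cases "r = 0")
    case True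
    then show ?thesis
      by (rule r0)
  next
    case False
    show ?thesis
    proof (cases "p = 0 \<and> q = 0 \<or> p ^ 3 = q ^ 3 \<and> q ^ 3 = r ^ 3")
      case True
      then show ?thesis
      proof
        assume "p = 0 \<and> q = 0"
        then show ?thesis
          using monomial False
          by (simp add: sklyanin_relations_form sklyanin_form_def span_scale_three letter_eq_word)
      next
        assume "p ^ 3 = q ^ 3 \<and> q ^ 3 = r ^ 3"
        then show ?thesis
          using cubes False by simp
      qed
    next
      case not_cubes: False
      then obtain t :: 'k where "(p + q) ^ 3 + r ^ 3 = 0" "t ^ 2 + t + 1 = 0"
        using assms False by auto
      then show ?thesis
        using not_cubes by (intro PBW_sum_cube [of p q r t] False) auto
    qed
  qed
qed


section \<open>Cubic relations of Sklyanin algebras\<close>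

definition sklyanin_rel :: "'k::field \<Rightarrow> 'k \<Rightarrow> 'k \<Rightarrow> xyz \<Rightarrow> (xyz, 'k) free_algebra" where
  "sklyanin_rel p q r a = (case a of
      X \<Rightarrow> sklyanin_form p q r (letter X) (letter Y) (letter Z)
    | Y \<Rightarrow> sklyanin_form p q r (letter Y) (letter Z) (letter X)
    | Z \<Rightarrow> sklyanin_form p q r (letter Z) (letter X) (letter Y))"

lemma sklyanin_relations_rel: "sklyanin_relations p q r = free_algebra.span (range (sklyanin_rel p q r))"
  by (simp add: sklyanin_relations_form UNIV_xyz sklyanin_rel_def)

text \<open>
  If \<open>p\<close> or \<open>q\<close> vanishes, this is immediate. Otherwise eliminating the \<open>a\<close>'s shows that each step in the
  cycle \<open>b1\<close>, \<open>b2\<close>, \<open>b3\<close> is multiplication by \<open>q\<^sup>2 / (p r)\<close> and that two steps are multiplication by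
  \<open>p q / r\<^sup>2\<close>. For a nonzero solution the latter forces \<open>p\<^sup>3 = q\<^sup>3\<close>, and going once around the cycle
  forces \<open>q\<^sup>6 = p\<^sup>3 r\<^sup>3\<close>, so that all cubes are equal.
\<close>

lemma cyclic_system_trivial:
  fixes p q r :: "'k::field"
  assumes r: "r \<noteq> 0" and pq: "p \<noteq> 0 \<or> q \<noteq> 0" and not_cubes: "\<not> (p ^ 3 = q ^ 3 \<and> q ^ 3 = r ^ 3)"
    and 1: "a1 * q = b1 * p" "a2 * q = b2 * p" "a3 * q = b3 * p"
    and 2: "a1 * r = b3 * q" "a2 * r = b1 * q" "a3 * r = b2 * q"
    and 3: "a1 * p = b2 * r" "a2 * p = b3 * r" "a3 * p = b1 * r"
  shows "a1 = 0 \<and> a2 = 0 \<and> a3 = 0 \<and> b1 = 0 \<and> b2 = 0 \<and> b3 = 0"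
proof -
  have b: "b1 = 0 \<and> b2 = 0 \<and> b3 = 0"
  proof (cases "p = 0 \<or> q = 0")
    case True
    then show ?thesis
      using r pq 1 2 3 by auto
  next
    case False
    then have pq: "p \<noteq> 0" "q \<noteq> 0"
      by auto
    have x: "q * q * b3 = p * r * b1" "q * q * b1 = p * r * b2" "q * q * b2 = p * r * b3"
      using 1 2 by algebra+
    have "p * q * b1 = r * r * b3"
      using 2 3 by algebra
    with x have x': "q * (p ^ 3 - q ^ 3) * b1 = 0" "(q ^ 3 * q ^ 3 - p ^ 3 * r ^ 3) * b1 = 0"
      by algebra+
    have "b1 = 0"
    proof (rule ccontr)
      assume b1: "b1 \<noteq> 0"
      have "p ^ 3 = q ^ 3"
        using x'(1) pq b1 by simp
      moreover from this have "q ^ 3 * q ^ 3 = q ^ 3 * r ^ 3"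
        using x'(2) b1 by simp
      then have "q ^ 3 = r ^ 3"
        using pq by (simp only: mult_cancel_left) simp
      ultimately show False
        using not_cubes by blast
    qed
    then show ?thesis
      using x pq r by auto
  qed
  then show ?thesis
    using 2 r by auto
qed

text \<open>
  Every word \<open>bc\<close> occurs in exactly one of the three relations: \<open>rel_index b c\<close> says in which one, and
  \<open>rel_coeff p q r b c\<close> is its coefficient there.
\<close>

definition rel_index :: "xyz \<Rightarrow> xyz \<Rightarrow> xyz" where
  "rel_index b c = (if b = c then b else THE a. a \<noteq> b \<and> a \<noteq> c)"

lemma rel_index_simps [simp]:
  "rel_index a a = a" "rel_index X Y = Z" "rel_index Y X = Z" "rel_index X Z = Y"
  "rel_index Z X = Y" "rel_index Y Z = X" "rel_index Z Y = X"
  by (auto simp: rel_index_def intro!: the_equality) (metis xyz.exhaust)+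

definition rel_coeff :: "'k \<Rightarrow> 'k \<Rightarrow> 'k \<Rightarrow> xyz \<Rightarrow> xyz \<Rightarrow> 'k" where
  "rel_coeff p q r b c =
     (if b = c then r else if (b, c) \<in> {(X, Y), (Y, Z), (Z, X)} then p else q)"

lemma coeff_sklyanin_rel:
  "coeff (sklyanin_rel p q r a) [b, c] = (if a = rel_index b c then rel_coeff p q r b c else 0)"
  by (cases a; cases b; cases c)
    (simp_all add: sklyanin_rel_def sklyanin_form_def coeff_simps rel_coeff_def)

text \<open>
  Number the letters by residues modulo 3, starting with \<open>x = 0\<close>. The coefficient of the word \<open>ijk\<close> only
  involves unknowns that belong to the residue of \<open>i + j + k\<close>, so the system splits into three parts. The
  part of residue 0 has the syzygy as its only solution up to scaling, which the hypothesis
  \<open>a X X = 0\<close> rules out. The other two parts are instances of \<open>cyclic_system_trivial\<close>, the last one with \<open>p\<close>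
  and \<open>q\<close> exchanged.
\<close>

lemma cubic_relations_independent:
  fixes p q r :: "'k::field"
  assumes r: "r \<noteq> 0" and pq: "p \<noteq> 0 \<or> q \<noteq> 0" and not_cubes: "\<not> (p ^ 3 = q ^ 3 \<and> q ^ 3 = r ^ 3)"
    and eq: "(\<Sum>i\<in>UNIV. \<Sum>l\<in>UNIV. scale (a i l) (letter i * sklyanin_rel p q r l)) =
      (\<Sum>i\<in>UNIV. \<Sum>l\<in>UNIV. scale (b i l) (sklyanin_rel p q r l * letter i))"
    and aXX: "a X X = 0"
  shows "a i l = 0 \<and> b i l = 0"
proof -
  have sum_if: "(\<Sum>x\<in>A. if P then g x else 0) = (if P then sum g A else 0)"
    for A :: "xyz set" and P and g :: "xyz \<Rightarrow> 'k"
    by simp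
  have *: "a i (rel_index j k) * rel_coeff p q r j k = b k (rel_index i j) * rel_coeff p q r i j"
    for i j k
  proof -
    have "coeff (\<Sum>i'\<in>UNIV. \<Sum>l\<in>UNIV. scale (a i' l) (letter i' * sklyanin_rel p q r l)) [i, j, k]
        = a i (rel_index j k) * rel_coeff p q r j k"
      by (simp add: lookup_sum coeff_letter_mult coeff_sklyanin_rel if_distrib [of "(*) _"] sum_if
          cong: if_cong)
    moreover have "coeff (\<Sum>i'\<in>UNIV. \<Sum>l\<in>UNIV. scale (b i' l) (sklyanin_rel p q r l * letter i')) ([i, j] @ [k])
        = b k (rel_index i j) * rel_coeff p q r i j"
      unfolding lookup_sum lookup_scale coeff_mult_letter
      by (simp add: coeff_sklyanin_rel if_distrib [of "(*) _"] sum_if cong: if_cong)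
    ultimately show ?thesis
      using eq by simp
  qed
  have coeffs: "rel_coeff p q r j j = r" "rel_coeff p q r X Y = p" "rel_coeff p q r Y Z = p"
    "rel_coeff p q r Z X = p" "rel_coeff p q r X Z = q" "rel_coeff p q r Z Y = q"
    "rel_coeff p q r Y X = q" for j
    by (simp_all add: rel_coeff_def)
  have diag: "a i i = 0 \<and> b i i = 0" for i
    using * [of X X X] * [of X Y Z] * [of X Z Y] * [of Y Y Y] * [of Y Z X] * [of Y X Z]
      * [of Z Z Z] * [of Z X Y] * [of Z Y X] aXX r pq
    by (cases i) (auto simp: coeffs)
  have "a X Z = 0 \<and> a Y X = 0 \<and> a Z Y = 0 \<and> b X Z = 0 \<and> b Y X = 0 \<and> b Z Y = 0"
    by (rule cyclic_system_trivial [OF r pq not_cubes])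
      (use * [of X Y X] * [of Y Z Y] * [of Z X Z] * [of X Z Z] * [of Y X X] * [of Z Y Y]
        * [of X X Y] * [of Y Y Z] * [of Z Z X] in \<open>simp_all add: coeffs\<close>)
  moreover have "a X Y = 0 \<and> a Z X = 0 \<and> a Y Z = 0 \<and> b X Y = 0 \<and> b Z X = 0 \<and> b Y Z = 0"
  proof (rule cyclic_system_trivial [OF r])
    show "q \<noteq> 0 \<or> p \<noteq> 0" "\<not> (q ^ 3 = p ^ 3 \<and> p ^ 3 = r ^ 3)"
      using pq not_cubes by auto
  qed (use * [of X Z X] * [of Y X Y] * [of Z Y Z] * [of X Y Y] * [of Y Z Z] * [of Z X X]
        * [of X X Z] * [of Y Y X] * [of Z Z Y] in \<open>simp_all add: coeffs\<close>)
  ultimately show ?thesis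
    using diag by (cases i; cases l) auto
qed

definition cubic_relation :: "'k::field \<Rightarrow> 'k \<Rightarrow> 'k \<Rightarrow> bool \<times> xyz \<times> xyz \<Rightarrow> (xyz, 'k) free_algebra" where
  "cubic_relation p q r = (\<lambda>(left, i, l).
     if left then letter i * sklyanin_rel p q r l else sklyanin_rel p q r l * letter i)"

text \<open>
  One of the 18 products is left out, because the syzygy expresses it by the others.
\<close>

lemma seventeen_cubic_relations:
  fixes p q r :: "'k::field"
  assumes r: "r \<noteq> 0" and pq: "p \<noteq> 0 \<or> q \<noteq> 0" and not_cubes: "\<not> (p ^ 3 = q ^ 3 \<and> q ^ 3 = r ^ 3)"
  obtains E where "E \<subseteq> range (cubic_relation p q r)" "free_algebra.independent E" "card E = 17"
proof -
  let ?S = "UNIV - {(True, X, X)}"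
  have zero: "c s = 0" if sum: "(\<Sum>s\<in>?S. scale (c s) (cubic_relation p q r s)) = 0" and s: "s \<in> ?S" for c s
  proof -
    define d where "d s = (if s = (True, X, X) then 0 else c s)" for s
    let ?f = "\<lambda>s. scale (d s) (cubic_relation p q r s)"
    have "(\<Sum>s\<in>UNIV. ?f s) = (\<Sum>s\<in>?S. ?f s)"
      by (rule sum.mono_neutral_right) (auto simp: d_def)
    also have "\<dots> = 0"
      unfolding sum [symmetric] by (rule sum.cong) (auto simp: d_def)
    finally have "(\<Sum>s\<in>UNIV \<times> UNIV \<times> UNIV. ?f s) = 0"
      by simp
    then have "(\<Sum>i\<in>UNIV. \<Sum>l\<in>UNIV. ?f (True, i, l)) + (\<Sum>i\<in>UNIV. \<Sum>l\<in>UNIV. ?f (False, i, l)) = 0"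
      unfolding sum.cartesian_product' by (simp add: UNIV_bool add.commute)
    then have "(\<Sum>i\<in>UNIV. \<Sum>l\<in>UNIV. scale (d (True, i, l)) (letter i * sklyanin_rel p q r l))
        = (\<Sum>i\<in>UNIV. \<Sum>l\<in>UNIV. scale (- d (False, i, l)) (sklyanin_rel p q r l * letter i))"
      by (simp add: cubic_relation_def sum_negf eq_neg_iff_add_eq_0)
    from cubic_relations_independent [OF r pq not_cubes this]
    have "d (True, i, l) = 0" "d (False, i, l) = 0" for i l
      by (simp_all add: d_def)
    then have "d s = 0"
      by (cases s rule: prod_cases3) (metis (full_types))
    then show ?thesis
      using s by (simp add: d_def)
  qed
  have family: "inj_on (cubic_relation p q r) ?S"
    "free_algebra.independent (cubic_relation p q r ` ?S)"
    by (rule family_independentI, simp, rule zero, assumption, assumption)+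
  have "card (UNIV :: xyz set) = 3"
    by (simp add: UNIV_xyz)
  then have "card ((UNIV :: bool set) \<times> (UNIV :: xyz set) \<times> (UNIV :: xyz set)) = 18"
    by (simp only: card_cartesian_product card_UNIV_bool)
  then have "card (UNIV :: (bool \<times> xyz \<times> xyz) set) = 18"
    by simp
  then have "card (cubic_relation p q r ` ?S) = 17"
    using card_image [OF family(1)] by (simp add: card_Diff_subset)
  moreover have "cubic_relation p q r ` ?S \<subseteq> range (cubic_relation p q r)"
    by auto
  ultimately show ?thesis
    using that family(2) by simp
qed


section \<open>The leading words of a quadratic Groebner basis\<close>

text \<open>
  If \<open>M\<close> consists of words of length 2, these are the words of length 3 that contain a word of \<open>M\<close>.
\<close>

definition cubic_words :: "'x list set \<Rightarrow> 'x list set" where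
  "cubic_words M = {m @ [c] | m c. m \<in> M} \<union> {a # m | a m. m \<in> M}"

text \<open>
  A word of \<open>M\<close> extends to the right in three ways and to the left in three ways, and this counts each
  overlap of two words of \<open>M\<close> twice.
\<close>

lemma card_cubic_words:
  fixes M :: "xyz list set"
  assumes "finite M" "\<And>m. m \<in> M \<Longrightarrow> length m = 2"
    and S: "\<And>a b c. [a, b, c] \<in> S \<Longrightarrow> [a, b] \<in> M \<and> [b, c] \<in> M"
    and S3: "\<And>w. w \<in> S \<Longrightarrow> length w = 3"
  shows "card (cubic_words M) + card S \<le> 6 * card M" "finite (cubic_words M)"
proof -
  let ?L = "(\<lambda>(m, c). m @ [c]) ` (M \<times> UNIV)" and ?R = "(\<lambda>(a, m). a # m) ` (UNIV \<times> M)"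
  have eq: "cubic_words M = ?L \<union> ?R"
    by (auto simp: cubic_words_def)
  have fin: "finite ?L" "finite ?R"
    using assms(1) by auto
  then show "finite (cubic_words M)"
    by (simp add: eq)
  have "S \<subseteq> ?L \<inter> ?R"
  proof
    fix w assume w: "w \<in> S"
    then obtain a b c where "w = [a, b, c]"
      using S3 [OF w] by (auto simp: numeral_3_eq_3 length_Suc_conv)
    moreover have "[a, b] \<in> M" "[b, c] \<in> M"
      using S w calculation by auto
    ultimately show "w \<in> ?L \<inter> ?R"
      by (force intro: image_eqI [of _ _ "([a, b], c)"] image_eqI [of _ _ "(a, [b, c])"])
  qed
  then have "card S \<le> card (?L \<inter> ?R)"
    using fin by (intro card_mono) auto
  moreover have "card ?L = card M * 3" "card ?R = 3 * card M"
    by (subst card_image; auto simp: inj_on_def card_cartesian_product UNIV_xyz)+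
  moreover have "card ?L + card ?R = card (?L \<union> ?R) + card (?L \<inter> ?R)"
    by (rule card_Un_Int) (rule fin)+
  ultimately show "card (cubic_words M) + card S \<le> 6 * card M"
    unfolding eq by linarith
qed

text \<open>
  By \<open>card_cubic_words\<close>, \<open>M\<close> has three elements and at most one overlap. A square \<open>aa\<close> overlaps itself,
  so the other two words would avoid \<open>a\<close> and not overlap, which is impossible with two remaining letters.
  If neither \<open>bc\<close> nor \<open>cb\<close> were in \<open>M\<close>, then \<open>M\<close> would contain both \<open>ab\<close> and \<open>ba\<close> or both \<open>ac\<close> and \<open>ca\<close>
  for the third letter \<open>a\<close>, and each of these pairs has two overlaps.
\<close>

lemma leading_words_acyclic:
  fixes M :: "xyz list set"
  assumes M: "finite M" "card M \<le> 3" "\<And>m. m \<in> M \<Longrightarrow> length m = 2"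
    and many: "17 \<le> card (cubic_words M)"
  shows "[a, a] \<notin> M" and "b \<noteq> c \<Longrightarrow> [b, c] \<in> M \<or> [c, b] \<in> M"
proof -
  have "card (cubic_words M) \<le> 6 * card M"
    using card_cubic_words [of M "{}"] M by simp
  then have card_M: "card M = 3"
    using many M(2) by linarith
  have not_two: "card M \<noteq> 3" if "M \<subseteq> {u, v}" for u v
  proof -
    have "card M \<le> card {u, v}"
      using that by (intro card_mono) auto
    also have "\<dots> \<le> 2"
      by (simp add: card_insert_if)
    finally show ?thesis
      by simp
  qed
  have unique: "a = a' \<and> b = b' \<and> c = c'"
    if "[a, b] \<in> M" "[b, c] \<in> M" "[a', b'] \<in> M" "[b', c'] \<in> M" for a b c a' b' c'
  proof (rule ccontr)
    assume "\<not> ?thesis"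
    then have "card {[a, b, c], [a', b', c']} = 2"
      by auto
    moreover have "card (cubic_words M) + card {[a, b, c], [a', b', c']} \<le> 6 * card M"
      using that by (intro card_cubic_words M) auto
    ultimately show False
      using many card_M by simp
  qed
  show no_loop: "[a, a] \<notin> M" for a
  proof
    assume a: "[a, a] \<in> M"
    have other: "b \<noteq> a \<and> c \<noteq> a \<and> b \<noteq> c" if "[b, c] \<in> M" "[b, c] \<noteq> [a, a]" for b c
    proof (intro conjI notI)
      show False if "b = a"
        using unique [OF a a a, of c] \<open>[b, c] \<in> M\<close> \<open>[b, c] \<noteq> [a, a]\<close> that by simp
      show False if "c = a"
        using unique [OF a a _ a, of b] \<open>[b, c] \<in> M\<close> \<open>[b, c] \<noteq> [a, a]\<close> that by simp
      show False if "b = c"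
        using unique [OF a a, of b b b] \<open>[b, c] \<in> M\<close> \<open>[b, c] \<noteq> [a, a]\<close> that by simp
    qed
    obtain b c where bc: "UNIV = {a, b, c}" "b \<noteq> a" "c \<noteq> a" "b \<noteq> c"
      using that [of Y Z] that [of X Z] that [of X Y] by (cases a) (auto simp: UNIV_xyz)
    have "M \<subseteq> {[a, a], [b, c], [c, b]}"
    proof
      fix m assume m: "m \<in> M"
      then obtain d e where de: "m = [d, e]"
        using M(3) by (fastforce simp: numeral_2_eq_2 length_Suc_conv)
      then show "m \<in> {[a, a], [b, c], [c, b]}"
        using other [of d e] m bc(1) by auto
    qed
    moreover have "\<not> ([b, c] \<in> M \<and> [c, b] \<in> M)"
      using unique [OF a a, of b c b] bc by auto
    ultimately have "M \<subseteq> {[a, a], [b, c]} \<or> M \<subseteq> {[a, a], [c, b]}"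
      by auto
    then show False
      using not_two card_M by blast
  qed
  show "[b, c] \<in> M \<or> [c, b] \<in> M" if "b \<noteq> c" for b c
  proof (rule ccontr)
    assume none: "\<not> ([b, c] \<in> M \<or> [c, b] \<in> M)"
    obtain a where a: "UNIV = {a, b, c}"
    proof -
      have "\<exists>a. UNIV = {a, b, c}"
        using \<open>b \<noteq> c\<close> by (cases b; cases c) (auto simp: UNIV_xyz)
      then show ?thesis
        using that by blast
    qed
    have no_two_cycle: "\<not> ([d, e] \<in> M \<and> [e, d] \<in> M)" for d e
      using unique [of d e d e d e] no_loop by auto
    have "M \<subseteq> {[a, b], [b, a], [a, c], [c, a]}"
    proof
      fix m assume m: "m \<in> M"
      then obtain d e where de: "m = [d, e]"
        using M(3) by (fastforce simp: numeral_2_eq_2 length_Suc_conv)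
      have "d \<in> {a, b, c}" "e \<in> {a, b, c}"
        unfolding a [symmetric] by auto
      then show "m \<in> {[a, b], [b, a], [a, c], [c, a]}"
        using no_loop [of d] none m de by auto
    qed
    then have "M \<subseteq> {[a, b], [a, c]} \<or> M \<subseteq> {[a, b], [c, a]} \<or> M \<subseteq> {[b, a], [a, c]} \<or> M \<subseteq> {[b, a], [c, a]}"
      using no_two_cycle [of a b] no_two_cycle [of a c] by blast
    then show False
      using not_two card_M by blast
  qed
qed

text \<open>
  A nonzero element of the span has a nonzero coefficient at its leading word, so restricting the
  coefficients to \<open>C\<close> is injective on the span.
\<close>

lemma card_le_of_leading_words:
  fixes E :: "('x, 'k::field) free_algebra set"
  assumes order: "word_order le" and C: "finite C"
    and E: "free_algebra.independent E"
    and lead: "\<And>f. f \<in> free_algebra.span E \<Longrightarrow> f \<noteq> 0 \<Longrightarrow> leading_word le f \<in> C"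
  shows "card E \<le> card C"
proof -
  define \<pi> where "\<pi> f = (\<Sum>w\<in>C. scale (coeff f w) (word w))" for f :: "('x, 'k) free_algebra"
  have coeff_\<pi>: "coeff (\<pi> f) w = coeff f w" if "w \<in> C" for f w
  proof -
    have "coeff (\<pi> f) w = (\<Sum>v\<in>C. if v = w then coeff f v else 0)"
      unfolding \<pi>_def lookup_sum by (rule sum.cong) (auto simp: lookup_word)
    then show ?thesis
      using that C by simp
  qed
  have hom: "module_hom scale scale \<pi>"
    unfolding module_hom_iff
    by (auto simp: \<pi>_def lookup_add free_algebra.scale_left_distrib sum.distrib
        free_algebra.scale_sum_right free_algebra.module_axioms)
  have "inj_on \<pi> (free_algebra.span E)"
  proof (rule inj_onI, rule ccontr)
    fix f g assume fg: "f \<in> free_algebra.span E" "g \<in> free_algebra.span E" "\<pi> f = \<pi> g" "f \<noteq> g"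
    let ?w = "leading_word le (f - g)"
    have fg': "f - g \<in> free_algebra.span E" "f - g \<noteq> 0"
      using fg by (auto intro: free_algebra.span_diff)
    have "?w \<in> C" "coeff (f - g) ?w \<noteq> 0"
      using lead [OF fg'] leading_word_in_support [OF order fg'(2)] by (simp_all add: in_keys_iff)
    then show False
      using coeff_\<pi> [of ?w f] coeff_\<pi> [of ?w g] fg(3) by (simp add: lookup_minus)
  qed
  then have "free_algebra.independent (\<pi> ` E)" "inj_on \<pi> E"
    using module_hom.independent_injective_image [OF hom E] free_algebra.span_superset
    by (auto intro: inj_on_subset)
  moreover have "\<pi> ` E \<subseteq> free_algebra.span (word ` C)"
    unfolding \<pi>_def
    by (intro image_subsetI free_algebra.span_sum free_algebra.span_scale free_algebra.span_base) auto
  ultimately have "card E \<le> card (word ` C :: ('x, 'k) free_algebra set)"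
    using free_algebra.independent_span_bound [of "word ` C" "\<pi> ` E"] C
    by (auto simp: card_image)
  also have "\<dots> \<le> card C"
    by (rule card_image_le [OF C])
  finally show ?thesis .
qed


section \<open>Necessity of the conditions\<close>

text \<open>
  Multiplying the three equations by \<open>a\<close>, \<open>b\<close> and \<open>c\<close> gives \<open>r a\<^sup>3 = r b\<^sup>3 = r c\<^sup>3 = - P a b c\<close>.
\<close>

lemma point_on_diagonal:
  fixes a b c P r :: "'k::field"
  assumes r: "r \<noteq> 0" and nz: "\<not> (a = 0 \<and> b = 0 \<and> c = 0)"
    and eqs: "P * (b * c) + r * (a * a) = 0" "P * (c * a) + r * (b * b) = 0"
      "P * (a * b) + r * (c * c) = 0"
  shows "P ^ 3 + r ^ 3 = 0" "a \<noteq> 0" "b \<noteq> 0" "c \<noteq> 0" "a ^ 3 = b ^ 3" "b ^ 3 = c ^ 3"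
proof -
  show abc: "a \<noteq> 0" "b \<noteq> 0" "c \<noteq> 0"
    using r nz eqs by auto
  have "r * (a ^ 3 - b ^ 3) = 0" "r * (b ^ 3 - c ^ 3) = 0"
    using eqs by algebra+
  then show "a ^ 3 = b ^ 3" "b ^ 3 = c ^ 3"
    using r by simp_all
  have "(P ^ 3 + r ^ 3) * (a * b * c) ^ 2 = 0"
    using eqs by algebra
  then show "P ^ 3 + r ^ 3 = 0"
    using abc by simp
qed

lemma no_cube_root_imp_eq:
  fixes a b :: "'k::field"
  assumes no_root: "\<And>t::'k. t ^ 2 + t + 1 \<noteq> 0" and "a ^ 3 = b ^ 3" "b \<noteq> 0"
  shows "a = b"
proof -
  have "b ^ 2 * ((a / b) ^ 2 + a / b + 1) = a ^ 2 + a * b + b ^ 2"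
    using assms(3) by (simp add: field_simps power2_eq_square)
  then have "a ^ 2 + a * b + b ^ 2 \<noteq> 0"
    using no_root [of "a / b"] assms(3) by auto
  moreover have "(a - b) * (a ^ 2 + a * b + b ^ 2) = 0"
    using assms(2) by algebra
  ultimately show ?thesis
    by simp
qed

lemma no_cube_root_form_anisotropic:
  fixes a b :: "'k::field"
  assumes no_root: "\<And>t::'k. t ^ 2 + t + 1 \<noteq> 0" and "a ^ 2 + a * b + b ^ 2 = 0"
  shows "a = 0" "b = 0"
proof -
  show b: "b = 0"
  proof (rule ccontr)
    assume b: "b \<noteq> 0"
    have "b ^ 2 * ((a / b) ^ 2 + a / b + 1) = a ^ 2 + a * b + b ^ 2"
      using b by (simp add: field_simps power2_eq_square)
    then show False
      using no_root [of "a / b"] b assms(2) by simp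
  qed
  then show "a = 0"
    using assms(2) by simp
qed

text \<open>
  As \<open>p + q + r = 0\<close>, the vector \<open>(1, 1, 1)\<close> is in the kernel. On differences of coordinates the determinant
  of the system is \<open>p\<^sup>2 + p q + q\<^sup>2\<close>.
\<close>

lemma circulant_kernel:
  fixes p q r u v w :: "'k::field"
  assumes no_root: "\<And>t::'k. t ^ 2 + t + 1 \<noteq> 0" and "p + q + r = 0" "r \<noteq> 0"
    and eqs: "r * u + q * w + p * v = 0" "p * w + r * v + q * u = 0"
  shows "u = v" "v = w"
proof -
  have "p ^ 2 + p * q + q ^ 2 \<noteq> 0"
    using no_cube_root_form_anisotropic [OF no_root, of p q] assms(2,3) by auto
  moreover have "(p ^ 2 + p * q + q ^ 2) * (v - u) = 0" "(p ^ 2 + p * q + q ^ 2) * (w - u) = 0"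
    using eqs assms(2) by algebra+
  ultimately show "u = v" "v = w"
    by auto
qed

text \<open>
  The ideal contains the 17 independent elements of degree 3, and the leading word of every nonzero
  combination of them has a factor among the at most three leading words of the basis \<open>G\<close>.
\<close>

lemma groebner_leading_words:
  fixes \<phi> \<psi> :: "(xyz, 'k::field) free_algebra \<Rightarrow> (xyz, 'k) free_algebra"
  assumes r: "r \<noteq> 0" and pq: "p \<noteq> 0 \<or> q \<noteq> 0" and not_cubes: "\<not> (p ^ 3 = q ^ 3 \<and> q ^ 3 = r ^ 3)"
    and change: "letter_change \<phi> \<psi>" and order: "word_order le"
    and G: "linear_basis G (\<psi> ` sklyanin_relations p q r)"
    and gb: "word_groebner le G (two_sided_ideal hull (\<psi> ` sklyanin_relations p q r))"
  shows "\<And>f. f \<in> \<psi> ` sklyanin_relations p q r \<Longrightarrow> f \<noteq> 0 \<Longrightarrow> length (leading_word le f) = 2"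
    and "\<And>f a. f \<in> \<psi> ` sklyanin_relations p q r \<Longrightarrow> f \<noteq> 0 \<Longrightarrow> leading_word le f \<noteq> [a, a]"
    and "\<And>b c. b \<noteq> c \<Longrightarrow> \<exists>f \<in> \<psi> ` sklyanin_relations p q r. f \<noteq> 0 \<and> leading_word le f \<in> {[b, c], [c, b]}"
proof -
  let ?R = "\<psi> ` sklyanin_relations p q r"
  let ?I = "two_sided_ideal hull ?R"
  have hom: "algebra_hom \<phi>" "algebra_hom \<psi>" and inv: "\<And>f. \<phi> (\<psi> f) = f" "\<And>f. \<psi> (\<phi> f) = f"
    and deg: "\<And>a. \<psi> (letter a) \<in> degree_one"
    using change by (auto simp: letter_change_def)
  have inj: "inj_on \<psi> S" for S
    by (rule inj_on_inverseI) (rule inv(1))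
  have span_G: "free_algebra.span G = ?R" and indep_G: "free_algebra.independent G"
    using G by (auto simp: linear_basis_def)
  have R_span: "?R = free_algebra.span (range (\<lambda>a. \<psi> (sklyanin_rel p q r a)))"
    by (simp add: sklyanin_relations_rel algebra_hom_span [OF hom(2), symmetric] image_image)
  have "card (range (\<lambda>a. \<psi> (sklyanin_rel p q r a))) \<le> 3"
    using card_image_le [of "UNIV :: xyz set" "\<lambda>a. \<psi> (sklyanin_rel p q r a)"] by (simp add: UNIV_xyz)
  then have G3: "finite G" "card G \<le> 3"
    using free_algebra.independent_span_bound [of "range (\<lambda>a. \<psi> (sklyanin_rel p q r a))" G]
      indep_G span_G R_span free_algebra.span_superset [of G] by auto
  have rel_deg: "\<psi> (sklyanin_rel p q r a) \<in> degree_two" for a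
    by (cases a) (auto simp: sklyanin_rel_def algebra_hom_sklyanin_form [OF hom(2)]
        intro!: sklyanin_form_degree_two deg)
  then have "range (\<lambda>a. \<psi> (sklyanin_rel p q r a)) \<subseteq> degree_two"
    by auto
  from free_algebra.span_minimal [OF this [unfolded degree_two_def] free_algebra.subspace_span]
  have "?R \<subseteq> degree_two"
    by (simp add: R_span degree_two_def)
  then have R_length: "length w = 2" if "f \<in> ?R" "w \<in> support f" for f w
    using degree_two_length that by blast
  define M where "M = leading_word le ` (G - {0})"
  have M_length: "length m = 2" if m: "m \<in> M" for m
  proof -
    obtain g where g: "g \<in> G" "g \<noteq> 0" "m = leading_word le g"
      using m by (auto simp: M_def)
    then have "g \<in> ?R"
      using free_algebra.span_base [of g G] span_G by simp
    then show ?thesis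
      using leading_word_in_support [OF order g(2)] R_length g(3) by simp
  qed
  have M3: "finite M" "card M \<le> 3"
  proof -
    show "finite M"
      using G3 by (simp add: M_def)
    have "card M \<le> card (G - {0})"
      unfolding M_def using G3 by (intro card_image_le) auto
    also have "\<dots> \<le> card G"
      using G3 by (intro card_mono) auto
    finally show "card M \<le> 3"
      using G3 by simp
  qed
  have reducible: "\<exists>m\<in>M. \<exists>u v. leading_word le f = u @ m @ v" if f: "f \<in> ?I" "f \<noteq> 0" for f
  proof -
    obtain g u v where "g \<in> G - {0}" "leading_word le f = u @ leading_word le g @ v"
      using gb f unfolding word_groebner_def by (auto simp: Ball_def Bex_def)
    then show ?thesis
      unfolding M_def by blast
  qed
  have R_lead: "leading_word le f \<in> M" if f: "f \<in> ?R" "f \<noteq> 0" for f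
  proof -
    obtain m u v where m: "m \<in> M" "leading_word le f = u @ m @ v"
      using reducible [OF hull_inc [OF f(1)] f(2)] by blast
    have "length (leading_word le f) = 2"
      using R_length [OF f(1) leading_word_in_support [OF order f(2)]] .
    then show ?thesis
      using m M_length [OF m(1)] by simp
  qed
  obtain E where E: "E \<subseteq> range (cubic_relation p q r)" "free_algebra.independent E" "card E = 17"
    using seventeen_cubic_relations [OF r pq not_cubes] .
  have cubic: "\<psi> (cubic_relation p q r s) \<in> ?I \<and>
      (\<forall>w\<in>support (\<psi> (cubic_relation p q r s)). length w = 3)" for s
  proof -
    obtain left i l where s: "s = (left, i, l)"
      by (rule prod_cases3)
    have "sklyanin_rel p q r l \<in> sklyanin_relations p q r"
      unfolding sklyanin_relations_rel by (intro free_algebra.span_base) simp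
    then have rel: "\<psi> (sklyanin_rel p q r l) \<in> ?I"
      by (intro hull_inc) simp
    have "\<psi> (letter i) * \<psi> (sklyanin_rel p q r l) \<in> ?I" "\<psi> (sklyanin_rel p q r l) * \<psi> (letter i) \<in> ?I"
      using two_sided_ideal_hull [of ?R] rel by (auto simp: two_sided_ideal_def)
    moreover have "length w = 3" if "w \<in> support (\<psi> (letter i) * \<psi> (sklyanin_rel p q r l))" for w
      using length_support_mult [OF degree_one_length [OF deg] degree_two_length [OF rel_deg] that] by simp
    moreover have "length w = 3" if "w \<in> support (\<psi> (sklyanin_rel p q r l) * \<psi> (letter i))" for w
      using length_support_mult [OF degree_two_length [OF rel_deg] degree_one_length [OF deg] that] by simp
    ultimately show ?thesis
      by (cases left) (simp_all add: s cubic_relation_def algebra_hom_mult [OF hom(2)])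
  qed
  have I_sub: "free_algebra.subspace ?I"
    using two_sided_ideal_hull [of ?R]
    by (auto simp: two_sided_ideal_def free_algebra.subspace_def scale_def)
  have span_E_I: "free_algebra.span (\<psi> ` E) \<subseteq> ?I"
    using E(1) cubic by (intro free_algebra.span_minimal I_sub) auto
  have span_E_length: "length w = 3" if "f \<in> free_algebra.span (\<psi> ` E)" "w \<in> support f" for f w
    by (rule length_support_span [OF _ that]) (use E(1) cubic in auto)
  have lead_cubic: "leading_word le f \<in> cubic_words M" if f: "f \<in> free_algebra.span (\<psi> ` E)" "f \<noteq> 0" for f
  proof -
    have "f \<in> ?I"
      using f(1) span_E_I by auto
    then obtain m u v where m: "m \<in> M" "leading_word le f = u @ m @ v"
      using reducible f(2) by blast
    have "length (leading_word le f) = 3"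
      using span_E_length [OF f(1) leading_word_in_support [OF order f(2)]] .
    then have "length u + length v = 1"
      using m M_length [OF m(1)] by simp
    then consider a where "u = [a]" "v = []" | a where "u = []" "v = [a]"
      by (cases u; cases v) auto
    then show ?thesis
      by cases (use m in \<open>auto simp: cubic_words_def\<close>)
  qed
  have "17 = card (\<psi> ` E)"
    using E(3) card_image [OF inj] by simp
  also have "\<dots> \<le> card (cubic_words M)"
  proof (rule card_le_of_leading_words [OF order])
    show "finite (cubic_words M)"
      using card_cubic_words(2) [of M "{}"] M3 M_length by simp
    show "free_algebra.independent (\<psi> ` E)"
      by (rule algebra_hom_independent [OF hom(2) inj E(2)])
  qed (rule lead_cubic)
  finally have many: "17 \<le> card (cubic_words M)" .
  have acyclic: "[a, a] \<notin> M" "b \<noteq> c \<Longrightarrow> [b, c] \<in> M \<or> [c, b] \<in> M" for a b c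
    by (rule leading_words_acyclic [OF M3 _ many]; simp add: M_length)+
  show "length (leading_word le f) = 2" if "f \<in> ?R" "f \<noteq> 0" for f
    using R_lead [OF that] by (rule M_length)
  show "leading_word le f \<noteq> [a, a]" if "f \<in> ?R" "f \<noteq> 0" for f a
    using R_lead [OF that] acyclic(1) [of a] by auto
  show "\<exists>f \<in> ?R. f \<noteq> 0 \<and> leading_word le f \<in> {[b, c], [c, b]}" if bc: "b \<noteq> c" for b c
  proof -
    obtain m where "m \<in> M" "m \<in> {[b, c], [c, b]}"
      using acyclic(2) [OF bc] by auto
    then obtain g where g: "g \<in> G" "g \<noteq> 0" "leading_word le g \<in> {[b, c], [c, b]}"
      by (auto simp: M_def)
    then have "g \<in> ?R"
      using free_algebra.span_base [of g G] span_G by simp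
    then show ?thesis
      using g by blast
  qed
qed

lemma letters_sorted:
  assumes "word_order (le :: xyz list rel)"
  obtains i j k where "UNIV = {i, j, k}" "i \<noteq> j" "i \<noteq> k" "j \<noteq> k" "([j], [i]) \<in> le" "([k], [j]) \<in> le"
proof -
  have total: "([a], [b]) \<in> le \<or> ([b], [a]) \<in> le" for a b
    by (rule word_order_total [OF assms])
  have "\<exists>i j k. UNIV = {i, j, k} \<and> i \<noteq> j \<and> i \<noteq> k \<and> j \<noteq> k \<and> ([j], [i]) \<in> le \<and> ([k], [j]) \<in> le"
  proof -
    have perm: "UNIV = {X, Y, Z}" "UNIV = {X, Z, Y}" "UNIV = {Y, X, Z}" "UNIV = {Y, Z, X}"
      "UNIV = {Z, X, Y}" "UNIV = {Z, Y, X}"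
      by (auto simp: UNIV_xyz)
    show ?thesis
      using total [of X Y] total [of Y Z] total [of X Z] perm
        word_order_trans [OF assms, of "[X]" "[Y]" "[Z]"] by (metis xyz.distinct)
  qed
  then show ?thesis
    using that by blast
qed

text \<open>
  In the proof, \<open>m a c\<close> is the coefficient of the new letter \<open>c\<close> in \<open>a\<close>, so the column of \<open>m\<close> at the largest
  new letter \<open>i\<close> consists of the coordinates of the point dual to \<open>i\<close>.
\<close>

lemma PBW_necessary:
  fixes p q r :: "'k::field"
  assumes PBW: "PBW (sklyanin_relations p q r)"
    and r: "r \<noteq> 0" and pq: "p \<noteq> 0 \<or> q \<noteq> 0" and not_cubes: "\<not> (p ^ 3 = q ^ 3 \<and> q ^ 3 = r ^ 3)"
  shows "(p + q) ^ 3 + r ^ 3 = 0" "\<exists>t::'k. t ^ 2 + t + 1 = 0"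
proof -
  obtain \<phi> \<psi> le G where change: "letter_change \<phi> \<psi>" and order: "word_order le"
    and G: "linear_basis G (\<psi> ` sklyanin_relations p q r)"
    and gb: "word_groebner le G (two_sided_ideal hull (\<psi> ` sklyanin_relations p q r))"
    using PBW unfolding PBW_iff by blast
  note lead = groebner_leading_words [OF r pq not_cubes change order G gb]
  let ?R = "\<psi> ` sklyanin_relations p q r"
  have hom: "algebra_hom \<psi>" and deg: "\<And>a. \<psi> (letter a) \<in> degree_one"
    and inv: "\<And>f. \<phi> (\<psi> f) = f"
    using change by (auto simp: letter_change_def)
  obtain i j k where ijk: "UNIV = {i, j, k}" "i \<noteq> j" "i \<noteq> k" "j \<noteq> k"
    and ji: "([j], [i]) \<in> le" and kj: "([k], [j]) \<in> le"
    using letters_sorted [OF order] .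
  have le_i: "([a], [i]) \<in> le" and le_k: "([k], [a]) \<in> le" for a
  proof -
    have "a \<in> {i, j, k}"
      unfolding ijk(1) [symmetric] by simp
    then show "([a], [i]) \<in> le" "([k], [a]) \<in> le"
      using ji kj word_order_trans [OF order kj ji] word_order_refl [OF order] by auto
  qed
  have le2: "([a, b], [c, d]) \<in> le" if "([a], [c]) \<in> le" "([b], [d]) \<in> le" for a b c d
    using word_order_trans [OF order word_order_append_right [OF order that(1), of "[b]"]
        word_order_append_left [OF order that(2), of "[c]"]] by simp
  have above: "coeff f w = 0" if "f \<noteq> 0" "(leading_word le f, w) \<in> le" "w \<noteq> leading_word le f" for f w
    using leading_word_max [OF order that(1), of w] word_order_antisym [OF order] that(2,3)
    by (auto simp: in_keys_iff)
  define m where "m a c = coeff (\<psi> (letter a)) [c]" for a c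
  define n where "n c a = coeff (\<phi> (letter c)) [a]" for a c
  define \<rho> where "\<rho> a = \<psi> (sklyanin_rel p q r a)" for a
  have nm: "n c X * m X d + n c Y * m Y d + n c Z * m Z d = (if c = d then 1 else 0)" for c d
    using letter_change_matrix [OF change, of c d] by (simp add: n_def m_def sum_xyz)
  have mn: "m a X * n X b + m a Y * n Y b + m a Z * n Z b = (if a = b then 1 else 0)" for a b
    using letter_change_matrix [OF letter_change_flip [OF change], of a b] by (simp add: n_def m_def sum_xyz)
  have rows_independent: "x = 0 \<and> y = 0 \<and> z = 0"
    if zero: "\<And>d. x * m X d + y * m Y d + z * m Z d = 0" for x y z
  proof -
    have "x * (m X X * n X b + m X Y * n Y b + m X Z * n Z b) + y * (m Y X * n X b + m Y Y * n Y b + m Y Z * n Z b)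
        + z * (m Z X * n X b + m Z Y * n Y b + m Z Z * n Z b)
        = (x * m X X + y * m Y X + z * m Z X) * n X b + (x * m X Y + y * m Y Y + z * m Z Y) * n Y b
        + (x * m X Z + y * m Y Z + z * m Z Z) * n Z b" for b
      by (simp add: algebra_simps)
    then have "x * (if X = b then 1 else 0) + y * (if Y = b then 1 else 0) + z * (if Z = b then 1 else 0) = 0" for b
      unfolding mn zero by simp
    from this [of X] this [of Y] this [of Z] show ?thesis
      by simp
  qed
  have coeff_\<rho>:
    "coeff (\<rho> X) [c, d] = p * (m Y c * m Z d) + q * (m Z c * m Y d) + r * (m X c * m X d)"
    "coeff (\<rho> Y) [c, d] = p * (m Z c * m X d) + q * (m X c * m Z d) + r * (m Y c * m Y d)"
    "coeff (\<rho> Z) [c, d] = p * (m X c * m Y d) + q * (m Y c * m X d) + r * (m Z c * m Z d)" for c d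
    by (simp_all add: \<rho>_def sklyanin_rel_def algebra_hom_simps [OF hom] sklyanin_form_def
        lookup_add coeff_mult_degree_one [OF deg] m_def)
  have \<rho>_R: "\<rho> a \<in> ?R" for a
    unfolding \<rho>_def sklyanin_relations_rel by (intro imageI free_algebra.span_base) simp
  have R_sum: "\<exists>u v w. f = scale u (\<rho> X) + scale v (\<rho> Y) + scale w (\<rho> Z)" if f: "f \<in> ?R" for f
  proof -
    have "f \<in> free_algebra.span {\<rho> X, \<rho> Y, \<rho> Z}"
      using f by (simp add: sklyanin_relations_rel algebra_hom_span [OF hom, symmetric] \<rho>_def UNIV_xyz)
    then obtain u v w where "f - scale u (\<rho> X) - scale v (\<rho> Y) - scale w (\<rho> Z) = 0"
      unfolding free_algebra.span_breakdown_eq by auto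
    then have "f = scale u (\<rho> X) + scale v (\<rho> Y) + scale w (\<rho> Z)"
      by (simp add: algebra_simps)
    then show ?thesis
      by blast
  qed
  have no_ii: "coeff f [i, i] = 0" if f: "f \<in> ?R" for f
  proof (rule ccontr)
    assume nz: "coeff f [i, i] \<noteq> 0"
    then have f0: "f \<noteq> 0"
      by auto
    obtain a b where ab: "leading_word le f = [a, b]"
      using lead(1) [OF f f0] by (auto simp: numeral_2_eq_2 length_Suc_conv)
    then have "(leading_word le f, [i, i]) \<in> le"
      using le2 le_i by simp
    then show False
      using above [OF f0, of "[i, i]"] lead(2) [OF f f0, of i] nz by auto
  qed
  have eqs: "(p + q) * (m Y i * m Z i) + r * (m X i * m X i) = 0"
    "(p + q) * (m Z i * m X i) + r * (m Y i * m Y i) = 0"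
    "(p + q) * (m X i * m Y i) + r * (m Z i * m Z i) = 0"
    using no_ii [OF \<rho>_R [of X]] no_ii [OF \<rho>_R [of Y]] no_ii [OF \<rho>_R [of Z]]
    by (simp_all add: coeff_\<rho> algebra_simps)
  have nz: "\<not> (m X i = 0 \<and> m Y i = 0 \<and> m Z i = 0)"
    using nm [of i i] by auto
  note point = point_on_diagonal [OF r nz eqs]
  show "(p + q) ^ 3 + r ^ 3 = 0"
    by (rule point(1))
  show "\<exists>t::'k. t ^ 2 + t + 1 = 0"
  proof (rule ccontr)
    assume "\<not> (\<exists>t::'k. t ^ 2 + t + 1 = 0)"
    then have no_root: "\<And>t::'k. t ^ 2 + t + 1 \<noteq> 0"
      by blast
    \<comment> \<open>If 1 is the only cube root of unity, nonzero coordinates with equal cubes are equal.\<close>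
    have XYi: "m X i = m Y i" and YZi: "m Y i = m Z i"
      using no_cube_root_imp_eq [OF no_root] point by auto
    have sum0: "p + q + r = 0"
    proof -
      have "(p + q + r) * (m X i * m X i) = 0"
        using eqs(1) XYi YZi by (simp add: algebra_simps)
      then show ?thesis
        using point(2) by simp
    qed
    obtain f where f: "f \<in> ?R" "f \<noteq> 0" "leading_word le f \<in> {[j, k], [k, j]}"
      using lead(3) [OF ijk(4)] by blast
    obtain u v w where uvw: "f = scale u (\<rho> X) + scale v (\<rho> Y) + scale w (\<rho> Z)"
      using R_sum [OF f(1)] by blast
    have jj: "coeff f [j, j] = 0"
      using f ijk le2 le_k kj word_order_refl [OF order] by (intro above) auto
    have "u = v \<and> v = w"
    proof (cases "leading_word le f = [j, k]")
      case True
      have "(r * u + q * w + p * v) * m X d + (p * w + r * v + q * u) * m Y d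
          + (q * v + p * u + r * w) * m Z d = 0" for d
      proof -
        have "coeff f [i, d] = 0"
          using True ijk le2 le_i le_k by (intro above f(2)) auto
        then have "m X i * ((r * u + q * w + p * v) * m X d + (p * w + r * v + q * u) * m Y d
            + (q * v + p * u + r * w) * m Z d) = 0"
          using XYi YZi by (simp add: uvw lookup_add coeff_\<rho> algebra_simps)
        then show ?thesis
          using point(2) by simp
      qed
      from rows_independent [OF this] show ?thesis
        using circulant_kernel [OF no_root sum0 r] by blast
    next
      case False
      have "(r * u + p * w + q * v) * m X d + (q * w + r * v + p * u) * m Y d
          + (p * v + q * u + r * w) * m Z d = 0" for d
      proof -
        have "coeff f [d, i] = 0"
          using False f(3) ijk le2 le_i le_k by (intro above f(2)) auto
        then have "m X i * ((r * u + p * w + q * v) * m X d + (q * w + r * v + p * u) * m Y d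
            + (p * v + q * u + r * w) * m Z d) = 0"
          using XYi YZi by (simp add: uvw lookup_add coeff_\<rho> algebra_simps)
        then show ?thesis
          using point(2) by simp
      qed
      moreover have "q + p + r = 0"
        using sum0 by (simp add: add.commute)
      ultimately show ?thesis
        using circulant_kernel [OF no_root _ r, of q p u w v] rows_independent by blast
    qed
    then have u: "v = u" "w = u" "u \<noteq> 0"
      using f(2) by (auto simp: uvw)
    \<comment> \<open>The coefficient of \<open>jj\<close> in a multiple of \<open>R1 + R2 + R3\<close>, with \<open>r = - (p + q)\<close>.\<close>
    have "u * r * ((m X j - m Y j) ^ 2 + (m X j - m Y j) * (m Y j - m Z j) + (m Y j - m Z j) ^ 2)
        = coeff f [j, j] - (p + q + r) * u * (m X j * m Y j + m Y j * m Z j + m Z j * m X j)"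
      by (simp add: uvw u lookup_add coeff_\<rho> algebra_simps power2_eq_square)
    then have "(m X j - m Y j) ^ 2 + (m X j - m Y j) * (m Y j - m Z j) + (m Y j - m Z j) ^ 2 = 0"
      using jj sum0 u(3) r by simp
    then have XYj: "m X j = m Y j" and YZj: "m Y j = m Z j"
      using no_cube_root_form_anisotropic [OF no_root, of "m X j - m Y j" "m Y j - m Z j"] by auto
    \<comment> \<open>The columns of \<open>m\<close> at \<open>i\<close> and \<open>j\<close> would be proportional.\<close>
    have "m Z i * (n i X + n i Y + n i Z) = 1" "m Z j * (n i X + n i Y + n i Z) = 0"
      "m Z j * (n j X + n j Y + n j Z) = 1"
      using nm [of i i] nm [of i j] nm [of j j] ijk XYi YZi XYj YZj by (simp_all add: algebra_simps)
    then show False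
      by auto
  qed
qed

theorem theorem1p2:
  fixes p q r :: "'k::field"
  shows "PBW (sklyanin_relations p q r) \<longleftrightarrow>
    (p * r = 0 \<and> q * r = 0) \<or>
    (p ^ 3 = q ^ 3 \<and> q ^ 3 = r ^ 3) \<or>
    ((p + q) ^ 3 + r ^ 3 = 0 \<and> (\<exists>t::'k. t ^ 2 + t + 1 = 0))"
proof
  assume "PBW (sklyanin_relations p q r)"
  from PBW_necessary [OF this] show "(p * r = 0 \<and> q * r = 0) \<or>
    (p ^ 3 = q ^ 3 \<and> q ^ 3 = r ^ 3) \<or>
    ((p + q) ^ 3 + r ^ 3 = 0 \<and> (\<exists>t::'k. t ^ 2 + t + 1 = 0))"
    by (cases "r = 0"; cases "p = 0 \<and> q = 0") auto
qed (rule PBW_sufficient)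

end
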